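(* Let $p = p(n) \in [1,\infty)$ and let $k\ge 2$ be an integer. If there exists a computable $(p, k)$-isolating parallelepiped, then there exists a polynomial-time reduction from any (Weighted-)Max-$k$-SAT instance with $n$ variables to a $\mathrm{CVP}_p$ instance of rank $n$.
   Context: For $1\le p\le\infty$ and integer $k\ge2$, a matrix $V\in\mathbb{R}^{d^*\times k}$ and a vector $\vec t^*\in\mathbb{R}^{d^*}$ define a $(p,k)$-isolating parallelepiped if $\|\vec t^*\|_p>1$ and $\|V\vec x-\vec t^*\|_p=1$ for all $\vec x\in\{0,1\}^k\setminus\{\vec 0_k\}$. Weighted Max-$k$-SAT: given a $k$-SAT formula (a conjunction of clauses $C_1,\dots,C_m$, each a disjunction of $k$ literals) on $n$ variables, a weight function $w$ assigning a positive integer to each clause, and a threshold $W$, decide whether some assignment $\vec a$ satisfies $\sum_{C_i \text{ satisfied by } \vec a} w(C_i)\ge W$ (Max-$k$-SAT is the unweighted case $w\equiv1$). A lattice of rank $n$ is $\mathcal{L}(B)=\{B\vec z:\vec z\in\mathbb{Z}^n\}$ for $B\in\mathbb{R}^{d\times n}$ with linearly independent columns; $\mathrm{CVP}_p$: given $B$, $\vec t\in\mathbb{R}^d$ and $r>0$, decide whether $\min_{\vec x\in\mathcal{L}(B)}\|\vec x-\vec t\|_p\le r$, where $\|\vec x\|_p=(\sum_i|x_i|^p)^{1/p}$. *)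

theory Defs
  imports "Jordan_Normal_Form.VS_Connect"
begin

section \<open>Isolating parallelepipeds\<close>

definition lp_norm :: "real \<Rightarrow> real vec \<Rightarrow> real" where
  "lp_norm p v = (\<Sum>i<dim_vec v. \<bar>v $ i\<bar> powr p) powr (1 / p)"

definition isolating_parallelepiped :: "real \<Rightarrow> nat \<Rightarrow> real mat \<Rightarrow> real vec \<Rightarrow> bool" where
  "isolating_parallelepiped p k V t \<longleftrightarrow>
     dim_col V = k \<and> dim_vec t = dim_row V \<and>
     lp_norm p t > 1 \<and>
     (\<forall>x \<in> carrier_vec k. (\<forall>i<k. x $ i \<in> {0, 1}) \<and> x \<noteq> 0\<^sub>v k \<longrightarrow>
        lp_norm p (V *\<^sub>v x - t) = 1)"


section \<open>Max-k-SAT\<close>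

text \<open>
  A literal is a sign (\<open>True\<close> for a positive literal) together with the index of a variable.
  Repetitions of literals, variables or clauses are not excluded.
\<close>

type_synonym literal = "bool \<times> nat"

record wsat =
  nvars :: nat
  wclauses :: "(literal list \<times> nat) list"
  threshold :: nat

definition sat_clause :: "(nat \<Rightarrow> bool) \<Rightarrow> literal list \<Rightarrow> bool" where
  "sat_clause a C \<longleftrightarrow> (\<exists>(s, x) \<in> set C. a x = s)"

definition weighted_max_ksat :: "nat \<Rightarrow> wsat set" where
  "weighted_max_ksat k =
     {I. \<forall>(C, w) \<in> set (wclauses I). length C = k \<and> (\<forall>(s, x) \<in> set C. x < nvars I) \<and> w > 0}"

definition max_ksat :: "nat \<Rightarrow> wsat set" where
  "max_ksat k = {I \<in> weighted_max_ksat k. \<forall>(C, w) \<in> set (wclauses I). w = 1}"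

definition satisfied_weight :: "wsat \<Rightarrow> (nat \<Rightarrow> bool) \<Rightarrow> nat" where
  "satisfied_weight I a = (\<Sum>(C, w) \<leftarrow> wclauses I. if sat_clause a C then w else 0)"

definition max_sat_yes :: "wsat \<Rightarrow> bool" where
  "max_sat_yes I \<longleftrightarrow> (\<exists>a. satisfied_weight I a \<ge> threshold I)"


section \<open>The closest vector problem\<close>

text \<open>The columns are required to be distinct because \<open>lin_dep\<close> is about sets of vectors.\<close>

definition lin_indep_cols :: "real mat \<Rightarrow> bool" where
  "lin_indep_cols B \<longleftrightarrow> distinct (cols B) \<and>
     \<not> LinearCombinations.module.lin_dep class_ring (module_vec TYPE(real) (dim_row B)) (set (cols B))"

definition lattice_of :: "real mat \<Rightarrow> real vec set" where
  "lattice_of B = {B *\<^sub>v map_vec of_int z | z :: int vec. z \<in> carrier_vec (dim_col B)}"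

type_synonym cvp = "real mat \<times> real vec \<times> real"

fun cvp_instance :: "nat \<Rightarrow> cvp \<Rightarrow> bool" where
  "cvp_instance n (B, t, r) \<longleftrightarrow>
     dim_col B = n \<and> lin_indep_cols B \<and> dim_vec t = dim_row B \<and> r > 0"

fun cvp_yes :: "real \<Rightarrow> cvp \<Rightarrow> bool" where
  "cvp_yes p (B, t, r) \<longleftrightarrow>
     (\<exists>x. is_arg_min (\<lambda>x. lp_norm p (x - t)) (\<lambda>x. x \<in> lattice_of B) x \<and> lp_norm p (x - t) \<le> r)"


section \<open>Polynomial time\<close>

text \<open>
  Instances of CVP consist of arbitrary real numbers, so algorithms are modelled as real RAM
  programs: a while language over binary trees whose leaves are either empty or hold an exact real
  number. Every assignment and every test costs one step. Trees are the immutable linked data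
  structures of such a machine: building a pair allocates one cell. Empty and nonempty trees play
  the role of the truth values; discrete data are trees without real leaves. The real operations
  are the field operations, exponentiation and comparison. There is no rounding, so the digits of
  a real number are not accessible in one step.
\<close>

datatype val = VNil | VPair val val | VReal real

fun vsize :: "val \<Rightarrow> nat" where
  "vsize VNil = 1"
| "vsize (VReal x) = 1"
| "vsize (VPair u v) = 1 + vsize u + vsize v"

definition enc_bool :: "bool \<Rightarrow> val" where
  "enc_bool b = (if b then VPair VNil VNil else VNil)"

datatype arith = Add | Sub | Mul | Div | Pow

fun arith_fun :: "arith \<Rightarrow> real \<Rightarrow> real \<Rightarrow> real" where
  "arith_fun Add x y = x + y"
| "arith_fun Sub x y = x - y"
| "arith_fun Mul x y = x * y"
| "arith_fun Div x y = x / y"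
| "arith_fun Pow x y = x powr y"

text \<open>The type parameter is the type of constants, so that the set function of the datatype
  collects the constants of a program.\<close>

datatype (exp_consts: 'c) exp =
    Var nat
  | Const 'c
  | ENil
  | EPair "'c exp" "'c exp"
  | Fst "'c exp"
  | Snd "'c exp"
  | Arith arith "'c exp" "'c exp"
  | Less "'c exp" "'c exp"

datatype (consts_of: 'c) com =
    Assign nat "'c exp"
  | Seq "'c com" "'c com"
  | Cond "'c exp" "'c com" "'c com"
  | While "'c exp" "'c com"

type_synonym state = "nat \<Rightarrow> val"

fun eval_exp :: "real exp \<Rightarrow> state \<Rightarrow> val" where
  "eval_exp (Var x) s = s x"
| "eval_exp (Const c) s = VReal c"
| "eval_exp ENil s = VNil"
| "eval_exp (EPair a b) s = VPair (eval_exp a s) (eval_exp b s)"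
| "eval_exp (Fst a) s = (case eval_exp a s of VPair u v \<Rightarrow> u | _ \<Rightarrow> VNil)"
| "eval_exp (Snd a) s = (case eval_exp a s of VPair u v \<Rightarrow> v | _ \<Rightarrow> VNil)"
| "eval_exp (Arith f a b) s =
     (case (eval_exp a s, eval_exp b s) of
        (VReal x, VReal y) \<Rightarrow> VReal (arith_fun f x y) | _ \<Rightarrow> VNil)"
| "eval_exp (Less a b) s =
     (case (eval_exp a s, eval_exp b s) of
        (VReal x, VReal y) \<Rightarrow> enc_bool (x < y) | _ \<Rightarrow> VNil)"

text \<open>\<open>exec c s m s'\<close>: started in state \<open>s\<close>, the program \<open>c\<close> stops after \<open>m\<close> steps in state \<open>s'\<close>.\<close>

inductive exec :: "real com \<Rightarrow> state \<Rightarrow> nat \<Rightarrow> state \<Rightarrow> bool" where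
  exec_Assign: "exec (Assign x e) s 1 (s(x := eval_exp e s))"
| exec_Seq: "exec c s l s' \<Longrightarrow> exec d s' m s'' \<Longrightarrow> exec (Seq c d) s (l + m) s''"
| exec_Cond_True: "eval_exp e s \<noteq> VNil \<Longrightarrow> exec c s m s' \<Longrightarrow> exec (Cond e c d) s (1 + m) s'"
| exec_Cond_False: "eval_exp e s = VNil \<Longrightarrow> exec d s m s' \<Longrightarrow> exec (Cond e c d) s (1 + m) s'"
| exec_While_False: "eval_exp e s = VNil \<Longrightarrow> exec (While e c) s 1 s"
| exec_While_True: "eval_exp e s \<noteq> VNil \<Longrightarrow> exec c s l s' \<Longrightarrow> exec (While e c) s' m s'' \<Longrightarrow>
    exec (While e c) s (1 + l + m) s''"

text \<open>Variable 0 holds the input and, at the end, the output; all other variables are empty at the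
  start.\<close>

definition computes_in :: "real com \<Rightarrow> val \<Rightarrow> nat \<Rightarrow> val \<Rightarrow> bool" where
  "computes_in c u m v \<longleftrightarrow> (\<exists>s. exec c ((\<lambda>_. VNil)(0 := u)) m s \<and> s 0 = v)"

text \<open>\<open>K\<close> is the set of real constants that programs may use besides 0 and 1; the functions are
  restricted to the domain \<open>A\<close>.\<close>

definition poly_time_computable ::
    "real set \<Rightarrow> 'a set \<Rightarrow> ('a \<Rightarrow> val) \<Rightarrow> ('b \<Rightarrow> val) \<Rightarrow> ('a \<Rightarrow> 'b) \<Rightarrow> bool" where
  "poly_time_computable K A enc_in enc_out f \<longleftrightarrow>
     (\<exists>(c :: real com) (q :: nat poly). consts_of c \<subseteq> K \<union> {0, 1} \<and>
        (\<forall>a \<in> A. \<exists>m \<le> poly q (vsize (enc_in a)). computes_in c (enc_in a) m (enc_out (f a))))"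


section \<open>Encodings\<close>

definition enc_list :: "('a \<Rightarrow> val) \<Rightarrow> 'a list \<Rightarrow> val" where
  "enc_list f xs = foldr (\<lambda>x v. VPair (f x) v) xs VNil"

definition enc_unary :: "nat \<Rightarrow> val" where
  "enc_unary n = enc_list (\<lambda>_. VNil) [0..<n]"

fun bits :: "nat \<Rightarrow> bool list" where
  "bits n = (if n = 0 then [] else odd n # bits (n div 2))"

declare bits.simps [simp del]

definition enc_binary :: "nat \<Rightarrow> val" where
  "enc_binary n = enc_list enc_bool (bits n)"

definition enc_vec :: "real vec \<Rightarrow> val" where
  "enc_vec v = enc_list VReal (list_of_vec v)"

definition enc_mat :: "real mat \<Rightarrow> val" where
  "enc_mat B = enc_list (enc_list VReal) (mat_to_list B)"

text \<open>Weights and threshold are in binary. The number of variables is in unary, since a lattice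
  of that rank has to be written down.\<close>

definition enc_wsat :: "wsat \<Rightarrow> val" where
  "enc_wsat I =
     VPair (enc_unary (nvars I))
       (VPair
         (enc_list (\<lambda>(C, w). VPair (enc_list (\<lambda>(s, x). VPair (enc_bool s) (enc_unary x)) C)
                                  (enc_binary w)) (wclauses I))
         (enc_binary (threshold I)))"

fun enc_cvp :: "cvp \<Rightarrow> val" where
  "enc_cvp (B, t, r) = VPair (enc_mat B) (VPair (enc_vec t) (VReal r))"

fun enc_parallelepiped :: "real \<times> real mat \<times> real vec \<Rightarrow> val" where
  "enc_parallelepiped (p, V, t) = VPair (VReal p) (VPair (enc_mat V) (enc_vec t))"


section \<open>Computable parallelepipeds and reductions to CVP\<close>

text \<open>
  The norm may depend on \<open>n\<close>, and then so may the parallelepiped, including its ambient dimension.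
  Computable means that, given \<open>n\<close>, the numbers \<open>p n\<close>, \<open>V n\<close>, \<open>t n\<close> can be produced in time
  polynomial in \<open>n\<close>. If \<open>p\<close> is constant, a fixed parallelepiped is computable whenever \<open>K\<close>
  contains \<open>p\<close> and its entries.
\<close>

definition computable_isolating_parallelepiped :: "real set \<Rightarrow> (nat \<Rightarrow> real) \<Rightarrow> nat \<Rightarrow> bool" where
  "computable_isolating_parallelepiped K p k \<longleftrightarrow>
     (\<exists>V t. (\<forall>n. isolating_parallelepiped (p n) k (V n) (t n)) \<and>
        poly_time_computable K UNIV enc_unary enc_parallelepiped (\<lambda>n. (p n, V n, t n)))"

definition reduces_to_cvp :: "real set \<Rightarrow> (nat \<Rightarrow> real) \<Rightarrow> wsat set \<Rightarrow> bool" where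
  "reduces_to_cvp K p A \<longleftrightarrow>
     (\<exists>f. poly_time_computable K A enc_wsat enc_cvp f \<and>
        (\<forall>I \<in> A. cvp_instance (nvars I) (f I) \<and>
           (max_sat_yes I \<longleftrightarrow> cvp_yes (p (nvars I)) (f I))))"

end

theory Submission
  imports Defs "Jordan_Normal_Form.DL_Rank"
begin

text \<open>
  The lattice basis has three kinds of rows. A clause of weight \<open>w\<close> contributes a copy of the
  parallelepiped, scaled by \<open>w powr (1 / p)\<close>, whose \<open>j\<close>-th column sits, up to sign, in the column of
  the variable of the \<open>j\<close>-th literal. A negative literal \<open>1 - z\<close> moves a column of the parallelepiped
  into the target. For a 0/1 vector the clause costs \<open>w\<close> if it is satisfied and \<open>w * \<tau>\<close> otherwise,
  where \<open>\<tau> > 1\<close> is the \<open>p\<close>-th power of the norm of the vector \<open>t\<close>. Every variable has a row costing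
  \<open>\<alpha> * \<bar>2 * z - 1\<bar> powr p\<close>, hence \<open>\<alpha>\<close> for a 0/1 value and at least \<open>3 * \<alpha>\<close> for all other integers.
  With total weight \<open>T\<close> and \<open>\<alpha> = 1 + T * \<tau>\<close>, the closest lattice vector comes from a 0/1 vector.
  A last row, zero in the basis, costs \<open>W * \<tau> + 1\<close>. An assignment of satisfied weight \<open>S\<close> thus costs
  \<open>S + (T - S) * \<tau> + n * \<alpha> + W * \<tau> + 1\<close>, which is at most \<open>W + (n + 1) * \<alpha>\<close> iff \<open>S \<ge> W\<close>; the last
  row keeps this bound positive even if \<open>W > T\<close>.

  All rows have one format, so a single program writes any of them. Since data may be shared, the
  size of the output of the given program need not be polynomial, but its height is, and the height
  bounds the number of rows of the parallelepiped.
\<close>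

section \<open>Reasoning about programs\<close>

text \<open>Total correctness with the step count in the postcondition. As the run is quantified
  existentially, the rules below are equivalences, and the simplifier can execute straight-line
  code.\<close>

definition run :: "real com \<Rightarrow> state \<Rightarrow> (nat \<Rightarrow> state \<Rightarrow> bool) \<Rightarrow> bool" where
  "run c s Q \<longleftrightarrow> (\<exists>m s'. exec c s m s' \<and> Q m s')"

inductive_cases exec_AssignE: "exec (Assign x e) s m s'"
inductive_cases exec_SeqE: "exec (Seq c d) s m s'"
inductive_cases exec_CondE: "exec (Cond e c d) s m s'"
inductive_cases exec_WhileE: "exec (While e c) s m s'"

lemma run_Assign [simp]: "run (Assign x e) s Q \<longleftrightarrow> Q 1 (s(x := eval_exp e s))"
  unfolding run_def by (auto intro: exec_Assign[simplified] elim: exec_AssignE)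

lemma run_Seq [simp]: "run (Seq c d) s Q \<longleftrightarrow> run c s (\<lambda>m s'. run d s' (\<lambda>m'. Q (m + m')))"
  unfolding run_def by (fastforce intro: exec_Seq elim: exec_SeqE)

lemma run_Cond [simp]: "run (Cond e c d) s Q \<longleftrightarrow>
    (if eval_exp e s \<noteq> VNil then run c s (\<lambda>m. Q (1 + m)) else run d s (\<lambda>m. Q (1 + m)))"
  unfolding run_def by (auto intro: exec_Cond_True[simplified] exec_Cond_False[simplified] elim!: exec_CondE)

text \<open>One unfolding of the loop. As a simp rule it would rewrite its own right-hand side
  without end.\<close>

lemma run_While: "run (While e c) s Q \<longleftrightarrow>
    (if eval_exp e s = VNil then Q 1 s
     else run c s (\<lambda>m s'. run (While e c) s' (\<lambda>m'. Q (1 + m + m'))))"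
proof (cases "eval_exp e s = VNil")
  case True
  then show ?thesis
    unfolding run_def by (auto intro: exec_While_False[simplified] elim: exec_WhileE)
next
  case False
  have "run (While e c) s Q" if "exec c s m s'" "exec (While e c) s' m' s''" "Q (1 + m + m') s''"
    for m s' m' s''
    using exec_While_True[OF False that(1,2)] that(3) unfolding run_def by blast
  moreover have "\<exists>m s' m'. exec c s m s' \<and> exec (While e c) s' m' t \<and> l = 1 + m + m'"
    if "exec (While e c) s l t" for l t
    using that by (rule exec_WhileE) (use False in auto)
  ultimately show ?thesis using False unfolding run_def by (simp only: if_False) metis
qed

lemma run_mono: "run c s P \<Longrightarrow> (\<And>m s'. P m s' \<Longrightarrow> Q m s') \<Longrightarrow> run c s Q"
  unfolding run_def by blast

section \<open>Frame properties and iteration over lists\<close>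

fun writes :: "'c com \<Rightarrow> nat set" where
  "writes (Assign x e) = {x}"
| "writes (Seq c d) = writes c \<union> writes d"
| "writes (Cond e c d) = writes c \<union> writes d"
| "writes (While e c) = writes c"

lemma exec_writes: "exec c s m s' \<Longrightarrow> x \<notin> writes c \<Longrightarrow> s' x = s x"
  by (induction rule: exec.induct) auto

text \<open>Frame rule: a specification \<open>P\<close> needs to mention only what a subprogram
  changes, since all variables outside \<open>writes c\<close> carry over.\<close>

lemma run_call:
  assumes "run c s P" and "\<And>m s'. P m s' \<Longrightarrow> (\<And>x. x \<notin> writes c \<Longrightarrow> s' x = s x) \<Longrightarrow> Q m s'"
  shows "run c s Q"
  using assms exec_writes unfolding run_def by blast

definition For :: "nat \<Rightarrow> nat \<Rightarrow> 'c com \<Rightarrow> 'c com" where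
  "For x l c = While (Var l) (Seq (Assign x (Fst (Var l))) (Seq (Assign l (Snd (Var l))) c))"

lemma writes_For [simp]: "writes (For x l c) = {x, l} \<union> writes c"
  by (auto simp: For_def)

lemma enc_list_simps [simp]:
  "enc_list f [] = VNil" "enc_list f (a # as) = VPair (f a) (enc_list f as)"
  by (simp_all add: enc_list_def)

text \<open>The invariant is indexed by the processed prefix, and the body may also use that
  variables the loop does not write keep their initial values. A round costs the test, two
  assignments and at most \<open>B\<close> steps; the final test adds 1.\<close>

lemma run_For:
  fixes xs :: "'a list" and B :: nat
  assumes "s l = enc_list f xs" and "Inv [] s" and "x \<noteq> l" and "l \<notin> writes c"
    and "\<And>ys a zs s'. xs = ys @ a # zs \<Longrightarrow> Inv ys s' \<Longrightarrow>
       (\<And>y. y \<notin> writes (For x l c) \<Longrightarrow> s' y = s y) \<Longrightarrow>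
       run c (s'(x := f a, l := enc_list f zs)) (\<lambda>m s''. m \<le> B \<and> Inv (ys @ [a]) s'')"
    and "\<And>m s'. Inv xs s' \<Longrightarrow> m \<le> 1 + length xs * (3 + B) \<Longrightarrow> (\<And>y. y \<notin> writes (For x l c) \<Longrightarrow> s' y = s y) \<Longrightarrow> Q m s'"
  shows "run (For x l c) s Q"
proof -
  have "run (For x l c) s' (\<lambda>m s''. Inv xs s'' \<and> m \<le> 1 + length zs * (3 + B))"
    if "xs = ys @ zs" "Inv ys s'" "s' l = enc_list f zs"
      "\<And>y. y \<notin> writes (For x l c) \<Longrightarrow> s' y = s y" for ys zs s'
    using that
  proof (induction zs arbitrary: ys s')
    case Nil
    then show ?case by (simp add: For_def run_While)
  next
    case (Cons a zs)
    let ?s = "s'(x := f a, l := enc_list f zs)"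
    have r: "run c ?s (\<lambda>m s''. m \<le> B \<and> Inv (ys @ [a]) s'')"
      using Cons.prems(1,2,4) by (rule assms(5))
    have "run c ?s (\<lambda>m s''. run (For x l c) s'' (\<lambda>m' s''. 
         Inv xs s'' \<and> 3 + m + m' \<le> 1 + length (a # zs) * (3 + B)))"
    proof (rule run_call[OF r])
      fix m s'' assume "m \<le> B \<and> Inv (ys @ [a]) s''" and fr: "\<And>x. x \<notin> writes c \<Longrightarrow> s'' x = ?s x"
      moreover have "s'' l = enc_list f zs" using fr[OF assms(4)] by simp
      moreover have "s'' y = s y" if "y \<notin> writes (For x l c)" for y
        using that fr[of y] Cons.prems(4)[of y] by simp
      ultimately show "run (For x l c) s'' (\<lambda>m' s''. 
         Inv xs s'' \<and> 3 + m + m' \<le> 1 + length (a # zs) * (3 + B))"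
        using Cons.IH[of "ys @ [a]" s''] Cons.prems by (auto elim: run_mono)
    qed
    then show ?case using Cons.prems(3) assms(3)
      by (subst For_def, subst run_While) (simp add: For_def[symmetric] fun_upd_twist add.commute add.left_commute)
  qed
  from this[of "[]" xs s] assms(1,2)
  have "run (For x l c) s (\<lambda>m s''. Inv xs s'' \<and> m \<le> 1 + length xs * (3 + B))" by simp
  then show ?thesis by (rule run_call) (use assms(6) in blast)
qed

section \<open>Running a program on renamed variables\<close>

fun shift_exp :: "nat \<Rightarrow> 'c exp \<Rightarrow> 'c exp" where
  "shift_exp N (Var x) = Var (x + N)"
| "shift_exp N (Const c) = Const c"
| "shift_exp N ENil = ENil"
| "shift_exp N (EPair a b) = EPair (shift_exp N a) (shift_exp N b)"
| "shift_exp N (Fst a) = Fst (shift_exp N a)"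
| "shift_exp N (Snd a) = Snd (shift_exp N a)"
| "shift_exp N (Arith f a b) = Arith f (shift_exp N a) (shift_exp N b)"
| "shift_exp N (Less a b) = Less (shift_exp N a) (shift_exp N b)"

fun shift :: "nat \<Rightarrow> 'c com \<Rightarrow> 'c com" where
  "shift N (Assign x e) = Assign (x + N) (shift_exp N e)"
| "shift N (Seq c d) = Seq (shift N c) (shift N d)"
| "shift N (Cond e c d) = Cond (shift_exp N e) (shift N c) (shift N d)"
| "shift N (While e c) = While (shift_exp N e) (shift N c)"

lemma consts_shift_exp [simp]: "exp_consts (shift_exp N e) = exp_consts e"
  by (induction e) auto

lemma consts_shift [simp]: "consts_of (shift N c) = consts_of c"
  by (induction c) auto

definition glue :: "nat \<Rightarrow> state \<Rightarrow> state \<Rightarrow> state" where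
  "glue N t s = (\<lambda>y. if y < N then t y else s (y - N))"

lemma eval_shift [simp]: "eval_exp (shift_exp N e) (glue N t s) = eval_exp e s"
  by (induction e) (simp_all add: glue_def)

lemma glue_upd: "(glue N t s)(x + N := v) = glue N t (s(x := v))"
  by (rule ext) (auto simp: glue_def)

text \<open>A shifted program cannot reach the variables below \<open>N\<close>, so whatever the
  surrounding program keeps there survives, and its steps correspond one to one to those of the
  original.\<close>

lemma exec_shift: "exec c s m s' \<Longrightarrow> exec (shift N c) (glue N t s) m (glue N t s')"
proof (induction rule: exec.induct)
  case (exec_Assign x e s)
  show ?case using exec.exec_Assign[of "x+N" "shift_exp N e" "glue N t s"] unfolding glue_upd eval_shift shift.simps .
qed (auto intro: exec.intros[simplified])

section \<open>Height of the data a program can build\<close>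

fun height :: "val \<Rightarrow> nat" where
  "height VNil = 0"
| "height (VReal x) = 0"
| "height (VPair u v) = 1 + max (height u) (height v)"

text \<open>Bounds how far an expression can exceed the height of the values it reads.
  \<open>Less\<close> counts 1 since truth is encoded by a pair; arithmetic yields leaves.\<close>

fun growth_exp :: "'c exp \<Rightarrow> nat" where
  "growth_exp (EPair a b) = 1 + max (growth_exp a) (growth_exp b)"
| "growth_exp (Fst a) = growth_exp a"
| "growth_exp (Snd a) = growth_exp a"
| "growth_exp (Less a b) = 1"
| "growth_exp _ = 0"

fun growth :: "'c com \<Rightarrow> nat" where
  "growth (Assign x e) = growth_exp e"
| "growth (Seq c d) = max (growth c) (growth d)"
| "growth (Cond e c d) = max (growth c) (growth d)"
| "growth (While e c) = growth c"

lemma height_eval: "(\<And>x. height (s x) \<le> H) \<Longrightarrow> height (eval_exp e s) \<le> H + growth_exp e"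
proof (induction e)
  case (EPair a b)
  then show ?case by fastforce
next
  case (Fst e)
  then show ?case by (fastforce split: val.splits)
next
  case (Snd e)
  then show ?case by (fastforce split: val.splits)
qed (auto split: val.splits simp: enc_bool_def)

text \<open>One step may double the size, as assigning \<open>EPair (Var 0) (Var 0)\<close> does,
  but it raises the maximal height only by the growth of one expression. \<open>H\<close> varies in
  the induction because later commands start from the raised bound.\<close>

lemma height_exec:
  "exec c s m s' \<Longrightarrow> (\<And>x. height (s x) \<le> H) \<Longrightarrow> growth c \<le> G \<Longrightarrow> height (s' x) \<le> H + m * G"
proof (induction arbitrary: H x rule: exec.induct)
  case (exec_Assign y e s)
  then show ?case using height_eval[of s H e] by (auto intro: trans_le_add1 order_trans)
next
  case (exec_Seq c s l s' d m s'')
  have "height (s'' x) \<le> (H + l * G) + m * G"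
    using exec_Seq.prems by (intro exec_Seq.IH) auto
  then show ?case by (simp add: algebra_simps)
next
  case (exec_Cond_True e s c m s' d)
  have "height (s' x) \<le> H + m * G"
    using exec_Cond_True.prems by (intro exec_Cond_True.IH) auto
  then show ?case by (simp add: algebra_simps)
next
  case (exec_Cond_False e s d m s' c)
  have "height (s' x) \<le> H + m * G"
    using exec_Cond_False.prems by (intro exec_Cond_False.IH) auto
  then show ?case by (simp add: algebra_simps)
next
  case (exec_While_False e s c)
  then show ?case by (simp add: trans_le_add1)
next
  case (exec_While_True e s c l s' m s'')
  have "height (s'' x) \<le> (H + l * G) + m * G"
    using exec_While_True.prems by (intro exec_While_True.IH) auto
  then show ?case by (simp add: algebra_simps)
qed

lemma length_le_height: "length xs \<le> height (enc_list f xs)"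
  by (induction xs) auto

lemma length_le_vsize: "length xs \<le> vsize (enc_list f xs)"
  by (induction xs) auto

lemma height_le_vsize: "height v \<le> vsize v"
  by (induction v) auto

section \<open>The program\<close>

text \<open>
  The given program is shifted to the variables from 50 on. The main variables below 50 are
  2: \<open>p\<close>; 3, 4: \<open>V\<close>, \<open>t\<close>; 5, 6: \<open>n\<close> in unary and as a real; 7, 8: rows and target entries so far;
  9 to 12: weight, clause, coefficients and offset of the row to be written; 13: column;
  14, 15: results of \<open>coef_prog\<close>; 31: total weight; 35: threshold; 36: \<open>\<alpha>\<close>; 40: \<open>\<tau>\<close>.
  The others are loop variables and scratch space.
\<close>

abbreviation assign_com (infix "::=" 62) where "x ::= e \<equiv> Assign x e"
abbreviation seq_com (infixr ";;" 61) where "c ;; d \<equiv> Seq c d"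
abbreviation add_exp (infixl "\<^bold>+" 65) where "a \<^bold>+ b \<equiv> Arith Add a b"
abbreviation sub_exp (infixl "\<^bold>-" 65) where "a \<^bold>- b \<equiv> Arith Sub a b"
abbreviation mul_exp (infixl "\<^bold>*" 70) where "a \<^bold>* b \<equiv> Arith Mul a b"
abbreviation div_exp (infixl "\<^bold>'/" 70) where "a \<^bold>/ b \<equiv> Arith Div a b"
abbreviation pow_exp (infixr "\<^bold>^" 75) where "a \<^bold>^ b \<equiv> Arith Pow a b"

section \<open>Reading unary and binary numbers\<close>

lemma enc_unary_0 [simp]: "enc_unary 0 = VNil"
  by (simp add: enc_unary_def)

lemma enc_list_const: "length xs = length ys \<Longrightarrow> enc_list (\<lambda>_. v) xs = enc_list (\<lambda>_. v) ys"
  by (induction xs ys rule: list_induct2) auto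

lemma enc_unary_Suc [simp]: "enc_unary (Suc n) = VPair VNil (enc_unary n)"
  using enc_list_const[of "[0..<Suc n]" "0 # [0..<n]" VNil] by (simp add: enc_unary_def)

definition read_unary :: "nat \<Rightarrow> nat \<Rightarrow> nat \<Rightarrow> real com" where
  "read_unary d x l = (d ::= Const 0 ;; For x l (d ::= Var d \<^bold>+ Const 1))"

lemma writes_read_unary [simp]: "writes (read_unary d x l) = {d, x, l}"
  by (auto simp: read_unary_def)

lemma run_read_unary:
  assumes "s l = enc_unary n" "d \<noteq> x" "d \<noteq> l" "x \<noteq> l"
  shows "run (read_unary d x l) s (\<lambda>m s'. m \<le> 2 + 4 * n \<and> s' d = VReal (real n))"
  unfolding read_unary_def run_Seq run_Assign
proof (rule run_For[where f = "\<lambda>_. VNil" and xs = "[0..<n]" and B = 1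
        and Inv = "\<lambda>ys s. s d = VReal (real (length ys))"], goal_cases)
  case (5 ys a zs s')
  show ?case using 5(2) assms(2-4) by simp
qed (use assms in \<open>simp_all add: enc_unary_def\<close>)

text \<open>The bits come least significant first, so variable 28 holds the current power of two.
  The assignment of variable 9 to itself replaces a skip command.\<close>

definition read_binary :: "real com" where
  "read_binary = (9 ::= Const 0 ;; 28 ::= Const 1 ;;
     For 30 29 (Cond (Var 30) (9 ::= Var 9 \<^bold>+ Var 28) (9 ::= Var 9) ;;
       28 ::= Var 28 \<^bold>+ Var 28))"

lemma writes_read_binary [simp]: "writes read_binary = {9, 28, 29, 30}"
  by (auto simp: read_binary_def)

lemma horner_bits: "horner_sum of_bool 2 (bits n) = real n"
proof (induction n rule: bits.induct)
  case (1 n)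
  show ?case
  proof (cases "n = 0")
    case True
    then show ?thesis by (simp add: bits.simps)
  next
    case False
    have "n = of_bool (odd n) + 2 * (n div 2)"
      by (cases "odd n") simp_all
    from arg_cong[OF this, of real] have "real n = of_bool (odd n) + 2 * real (n div 2)"
      unfolding of_nat_add of_nat_mult by simp
    then show ?thesis using 1[OF False] False by (subst bits.simps) simp
  qed
qed

lemma run_read_binary:
  assumes "s 29 = enc_binary w"
  shows "run read_binary s (\<lambda>m s'. m \<le> 3 + 6 * length (bits w) \<and> s' 9 = VReal (real w))"
  unfolding read_binary_def run_Seq run_Assign
proof (rule run_For[where f = enc_bool and xs = "bits w" and B = 3
        and Inv = "\<lambda>ys s. s 9 = VReal (horner_sum of_bool 2 ys) \<and> s 28 = VReal (2 ^ length ys)"], goal_cases)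
  case (5 ys a zs s')
  show ?case using 5(2) by (cases a) (simp_all add: horner_sum_append enc_bool_def)
qed (use assms in \<open>simp_all add: enc_binary_def horner_bits\<close>)

section \<open>Entries and rows of the basis\<close>

fun enc_lit :: "literal \<Rightarrow> val" where
  "enc_lit (s, x) = VPair (enc_bool s) (enc_unary x)"

text \<open>A sum, because a variable may occur several times in a clause, even with both
  signs.\<close>

definition coef :: "nat \<Rightarrow> literal list \<Rightarrow> real list \<Rightarrow> real" where
  "coef y C vs = (\<Sum>((s, x), v) \<leftarrow> zip C vs. if x = y then if s then v else - v else 0)"

definition negated_sum :: "literal list \<Rightarrow> real list \<Rightarrow> real" where
  "negated_sum C vs = (\<Sum>((s, x), v) \<leftarrow> zip C vs. if s then 0 else v)"

text \<open>Extends loop invariants by one element: they zip the processed prefix of one list with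
  the whole of the other.\<close>

lemma zip_snoc_left:
  "length ys < length vs \<Longrightarrow> zip (ys @ [a]) vs = zip ys vs @ [(a, vs ! length ys)]"
proof (induction ys arbitrary: vs)
  case Nil
  then show ?case by (cases vs) auto
next
  case (Cons y ys)
  then show ?case by (cases vs) auto
qed

text \<open>Equality of the real numbers \<open>x\<close> and \<open>y\<close> is tested without branching: since \<open>0 / 0 = 0\<close>, the
  number \<open>1 - (x - y) / (x - y)\<close> is 1 if they are equal and 0 otherwise.\<close>

definition coef_prog :: "real com" where
  "coef_prog = (14 ::= Const 0 ;; 15 ::= Const 0 ;; 18 ::= Var 11 ;; 16 ::= Var 10 ;;
     For 17 16 (20 ::= Snd (Var 17) ;; read_unary 19 21 20 ;;
       22 ::= Fst (Var 18) \<^bold>* (Const 1 \<^bold>- (Var 19 \<^bold>- Var 13) \<^bold>/ (Var 19 \<^bold>- Var 13)) ;;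
       Cond (Fst (Var 17)) (14 ::= Var 14 \<^bold>+ Var 22)
         (14 ::= Var 14 \<^bold>- Var 22 ;; 15 ::= Var 15 \<^bold>+ Fst (Var 18)) ;;
       18 ::= Snd (Var 18)))"

lemma writes_coef_prog [simp]: "writes coef_prog = {14, 15, 16, 17, 18, 19, 20, 21, 22}"
  by (auto simp: coef_prog_def)

definition coef_time :: "nat \<Rightarrow> nat \<Rightarrow> nat" where
  "coef_time k n = 5 + k * (11 + 4 * n)"

text \<open>The length of \<open>C\<close> is only bounded by \<open>k\<close>, because the row of a
  variable has a single literal and the last row has none.\<close>

lemma run_coef_prog:
  assumes "s 10 = enc_list enc_lit C" "s 11 = enc_list VReal vs" "s 13 = VReal (real y)"
    and "length C = length vs" "length C \<le> k" "\<And>b x. (b, x) \<in> set C \<Longrightarrow> x \<le> n"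
  shows "run coef_prog s (\<lambda>m s'. m \<le> coef_time k n \<and> s' 14 = VReal (coef y C vs) \<and> s' 15 = VReal (negated_sum C vs))"
  unfolding coef_prog_def run_Seq run_Assign
proof (rule run_For[where f = enc_lit and xs = C and B = "8 + 4 * n"
        and Inv = "\<lambda>ys s. s 14 = VReal (coef y ys vs) \<and> s 15 = VReal (negated_sum ys vs) \<and>
          s 18 = enc_list VReal (drop (length ys) vs)"], goal_cases)
  case (5 ys a zs s')
  obtain b x where a: "a = (b, x)" by (cases a)
  have len: "length ys < length vs" using assms(4) by (simp add: 5(1))
  have x: "x \<le> n" using assms(6) 5(1) a by auto
  have d: "drop (length ys) vs = vs ! length ys # drop (Suc (length ys)) vs"
    using len by (simp add: Cons_nth_drop_Suc)
  have s13: "s' 13 = VReal (real y)" using 5(3)[of 13] assms(3) by simp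
  show ?case
    unfolding run_Seq run_Assign
    by (rule run_call[OF run_read_unary[where n = x]])
      (use 5(2) s13 x in \<open>auto simp: a d coef_def negated_sum_def zip_snoc_left[OF len] enc_bool_def\<close>)
next
  case (6 m s')
  have "length C * (11 + 4 * n) \<le> k * (11 + 4 * n)" using assms(5) by (rule mult_le_mono1)
  then show ?case using 6 by (simp add: coef_time_def algebra_simps)
qed (use assms in \<open>simp_all add: coef_def negated_sum_def\<close>)

text \<open>Weight, literals, coefficients of the literals, and offset; see \<open>cost\<close> below.\<close>

type_synonym gadget = "real \<times> literal list \<times> real list \<times> real"

fun gadget_row :: "real \<Rightarrow> nat \<Rightarrow> gadget \<Rightarrow> real list" where
  "gadget_row p n (w, C, vs, b) = map (\<lambda>y. w powr (1 / p) * coef y C vs) [0..<n]"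

fun gadget_target :: "real \<Rightarrow> gadget \<Rightarrow> real" where
  "gadget_target p (w, C, vs, b) = w powr (1 / p) * (b - negated_sum C vs)"

text \<open>The entries of a row are computed from the last column to the first because lists grow at the
  front. For the same reason the rows end up in reverse order.\<close>

definition emit_prog :: "real com" where
  "emit_prog = (13 ::= Const 0 ;; coef_prog ;; 23 ::= Var 9 \<^bold>^ (Const 1 \<^bold>/ Var 2) ;;
     8 ::= EPair (Var 23 \<^bold>* (Var 12 \<^bold>- Var 15)) (Var 8) ;;
     24 ::= ENil ;; 13 ::= Var 6 ;; 25 ::= Var 5 ;;
     For 26 25 (13 ::= Var 13 \<^bold>- Const 1 ;; coef_prog ;; 24 ::= EPair (Var 23 \<^bold>* Var 14) (Var 24)) ;;
     7 ::= EPair (Var 24) (Var 7))"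

lemma writes_emit_prog [simp]: "writes emit_prog =
    {7, 8, 13, 14, 15, 16, 17, 18, 19, 20, 21, 22, 23, 24, 25, 26}"
  by (auto simp: emit_prog_def)

definition emit_time :: "nat \<Rightarrow> nat \<Rightarrow> nat" where
  "emit_time k n = 8 + coef_time k n + n * (5 + coef_time k n)"

text \<open>The invariant handed from one program to the next. \<open>G\<close> lists the gadgets in
  the order of emission, hence the reversal.\<close>

definition emitted :: "real \<Rightarrow> nat \<Rightarrow> gadget list \<Rightarrow> state \<Rightarrow> bool" where
  "emitted p n G s \<longleftrightarrow> s 2 = VReal p \<and> s 5 = enc_unary n \<and> s 6 = VReal (real n) \<and>
     s 7 = enc_list (enc_list VReal) (map (gadget_row p n) (rev G)) \<and>
     s 8 = enc_list VReal (map (gadget_target p) (rev G))"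

lemma run_emit:
  assumes "emitted p n G s" "s 9 = VReal w" "s 10 = enc_list enc_lit C" "s 11 = enc_list VReal vs"
    "s 12 = VReal b" "length C = length vs" "length C \<le> k" "\<And>b x. (b, x) \<in> set C \<Longrightarrow> x \<le> n"
  shows "run emit_prog s (\<lambda>m s'. m \<le> emit_time k n \<and> emitted p n (G @ [(w, C, vs, b)]) s')"
  unfolding emit_prog_def run_Seq run_Assign
\<comment> \<open>The first call serves only to obtain \<open>negated_sum\<close> for the target
  entry. That number does not depend on the column, so column 0 is an arbitrary choice.\<close>
proof (rule run_call[OF run_coef_prog[where C = C and vs = vs and y = 0 and n = n and k = k]], goal_cases)
  case (7 m s')
  let ?e = "\<lambda>y. w powr (1 / p) * coef y C vs"
  note h = assms(1)[unfolded emitted_def]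
  have fr: "s' x = s x" if "x \<notin> {13} \<union> writes coef_prog" for x
    using 7(2)[of x] that by simp
  show ?case
    unfolding run_Seq run_Assign
  \<comment> \<open>After \<open>length ys\<close> rounds the last \<open>length ys\<close> entries
    of the row are in place, and variable 13 is the leftmost column done.\<close>
  proof (rule run_For[where f = "\<lambda>_. VNil" and xs = "[0..<n]" and B = "2 + coef_time k n" 
        and Inv = "\<lambda>ys s. s 13 = VReal (real (n - length ys)) \<and> 
          s 24 = enc_list VReal (map ?e [n - length ys..<n])"], goal_cases)
    case (5 ys a zs t)
    have len: "length ys < n"
      using arg_cong[OF 5(1), of length] by simp
    have t: "t 10 = enc_list enc_lit C" "t 11 = enc_list VReal vs" "t 23 = VReal (w powr (1 / p))"
      using 5(3)[of 10] 5(3)[of 11] 5(3)[of 23] fr[of 10] fr[of 11] fr[of 9] fr[of 2] assms h by simp_all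
    show ?case unfolding run_Seq run_Assign
    proof (rule run_call[OF run_coef_prog[where C = C and vs = vs and y = "n - Suc (length ys)" and n = n and k = k]], goal_cases)
      case (7 m t')
      have e: "[n - Suc (length ys)..<n] = (n - Suc (length ys)) # [n - length ys..<n]"
        using len by (subst upt_conv_Cons) (auto simp: Suc_diff_Suc)
      show ?case using 7(1) 7(2)[of 13] 7(2)[of 23] 7(2)[of 24] 5(2) len t e
        by (simp add: of_nat_diff)
    qed (use assms 5(2) t len in \<open>simp_all add: of_nat_diff\<close>)
  next
    case (6 l t)
    have t: "t x = s' x" if "x \<notin> {8, 13, 14, 15, 16, 17, 18, 19, 20, 21, 22, 23, 24, 25, 26}" for x
      using 6(3)[of x] that by simp
    have t8: "t 8 = VPair (VReal (w powr (1 / p) * (b - negated_sum C vs))) (s 8)"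
      using 6(3)[of 8] 7(1) fr[of 8] fr[of 9] fr[of 2] fr[of 12] h assms by simp
    have "m + l \<le> 1 + coef_time k n + n * (5 + coef_time k n)"
      using 6(2) 7(1) by simp
    then show ?case
      using h t[of 2] t[of 5] t[of 6] t[of 7] fr[of 2] fr[of 5] fr[of 6] fr[of 7] 6(1) t8
      by (simp add: emitted_def emit_time_def)
  qed (use 7 fr[of 5] fr[of 6] h in \<open>simp_all add: enc_unary_def\<close>)
qed (use assms in simp_all)

section \<open>Rows of the clauses\<close>

definition clause_prog :: "real com" where
  "clause_prog = (10 ::= Fst (Var 27) ;; 29 ::= Snd (Var 27) ;; read_binary ;; 31 ::= Var 31 \<^bold>+ Var 9 ;;
     32 ::= Var 3 ;; 33 ::= Var 4 ;;
     For 11 32 (12 ::= Fst (Var 33) ;; 33 ::= Snd (Var 33) ;; emit_prog))"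

lemma writes_clause_prog [simp]: "writes clause_prog = {9, 10, 11, 12, 28, 29, 30, 31, 32, 33} \<union> writes emit_prog"
  by (auto simp: clause_prog_def)

definition clause_gadgets :: "real list list \<Rightarrow> real list \<Rightarrow> literal list \<times> nat \<Rightarrow> gadget list" where
  "clause_gadgets V t = (\<lambda>(C, w). map (\<lambda>(vs, b). (real w, C, vs, b)) (zip V t))"

definition clause_time :: "nat \<Rightarrow> nat \<Rightarrow> nat \<Rightarrow> nat \<Rightarrow> nat" where
  "clause_time d l k n = 9 + 6 * l + d * (5 + emit_time k n)"

lemma run_clause:
  assumes "emitted p n G s" "s 27 = VPair (enc_list enc_lit C) (enc_binary w)" "s 31 = VReal T"
    "s 3 = enc_list (enc_list VReal) V" "s 4 = enc_list VReal t" "length V = length t"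
    "\<And>vs. vs \<in> set V \<Longrightarrow> length vs = length C" "length C \<le> k"
    "\<And>b x. (b, x) \<in> set C \<Longrightarrow> x \<le> n" "length (bits w) \<le> l"
  shows "run clause_prog s (\<lambda>m s'. m \<le> clause_time (length t) l k n \<and>
     emitted p n (G @ clause_gadgets V t (C, w)) s' \<and> s' 31 = VReal (T + real w))"
  unfolding clause_prog_def run_Seq run_Assign
proof (rule run_call[OF run_read_binary[where w = w]], goal_cases)
  case (2 m s')
  have fr: "s' x = s x" if "x \<notin> {9, 10, 28, 29, 30}" for x
    using 2(2)[of x] that by simp
  have s10: "s' 10 = enc_list enc_lit C" 
    using 2(2)[of 10] assms by simp
  note h = assms(1)[unfolded emitted_def]
  show ?case
    unfolding run_Seq run_Assign
  \<comment> \<open>The loop variable 11 runs through the rows of \<open>V\<close> and is already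
    where \<open>emit_prog\<close> expects the coefficients; variable 33 holds the target entries
    still to come.\<close>
  proof (rule run_For[where f = "enc_list VReal" and xs = V and B = "2 + emit_time k n" 
        and Inv = "\<lambda>ys s. s 33 = enc_list VReal (drop (length ys) t) \<and> 
          emitted p n (G @ clause_gadgets ys t (C, w)) s"], goal_cases)
    case (5 ys a zs u)
    have len: "length ys < length t" using assms(6) by (simp add: 5(1))
    have d: "drop (length ys) t = t ! length ys # drop (Suc (length ys)) t"
      using len by (simp add: Cons_nth_drop_Suc)
    have u: "u 10 = enc_list enc_lit C" "u 9 = VReal w" 
      using 5(3)[of 10] 5(3)[of 9] s10 2(1) by simp_all
    show ?case unfolding run_Seq run_Assign
    proof (rule run_call[OF run_emit[where C = C and vs = a and b = "t ! length ys" and w = w and n = n and p = p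
            and G = "G @ clause_gadgets ys t (C, w)" and k = k]], goal_cases)
      case (9 m u')
      then show ?case using 9(2)[of 33] 5(2) by (simp add: d clause_gadgets_def zip_snoc_left[OF len])
    next
      case 1
      then show ?case using 5(2) by (simp add: emitted_def)
    qed (use assms 5(2) u d in \<open>simp_all add: 5(1)\<close>)
  next
    case (6 l' u)
    have "u 31 = VReal (T + real w)"
      using 6(3)[of 31] fr[of 31] assms 2(1) by simp
    moreover have "m + l' \<le> 4 + 6 * l + length t * (5 + emit_time k n)"
      using 6(2) 2(1) assms(6,10) by simp
    ultimately show ?case
      using 6(1) by (simp add: clause_time_def)
  next
    case 2
    then show ?case using h fr[of 2] fr[of 5] fr[of 6] fr[of 7] fr[of 8] fr[of 4] assms(5)
      by (simp add: emitted_def clause_gadgets_def)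
  qed (use assms fr[of 3] in simp_all)
qed (use assms in simp_all)

text \<open>The square avoids an absolute value.\<close>

definition power_sum :: "real \<Rightarrow> real list \<Rightarrow> real" where
  "power_sum p xs = (\<Sum>x\<leftarrow>xs. (x * x) powr (p / 2))"

text \<open>Only 0 and 1 are sure to be admissible constants, so 2 is written as a sum. Lists that
  are needed again are copied first, since \<open>For\<close> consumes its list.\<close>

definition setup_prog :: "real com" where
  "setup_prog = (2 ::= Fst (Var 50) ;; 3 ::= Fst (Snd (Var 50)) ;; 4 ::= Snd (Snd (Var 50)) ;;
     5 ::= Fst (Var 0) ;; 25 ::= Var 5 ;; read_unary 6 26 25 ;; 40 ::= Const 0 ;; 41 ::= Var 4 ;;
     For 42 41 (40 ::= Var 40 \<^bold>+ (Var 42 \<^bold>* Var 42) \<^bold>^ (Var 2 \<^bold>/ (Const 1 \<^bold>+ Const 1))) ;;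
     7 ::= ENil ;; 8 ::= ENil ;; 31 ::= Const 0)"

lemma writes_setup_prog [simp]: "writes setup_prog = {2, 3, 4, 5, 6, 7, 8, 25, 26, 31, 40, 41, 42}"
  by (auto simp: setup_prog_def)

lemma run_setup:
  assumes "s 0 = VPair (enc_unary n) v"
    "s 50 = VPair (VReal p) (VPair V (enc_list VReal t))"
  shows "run setup_prog s (\<lambda>m s'. m \<le> 13 + 4 * n + 4 * length t \<and> emitted p n [] s' \<and>
     s' 3 = V \<and> s' 4 = enc_list VReal t \<and> s' 31 = VReal 0 \<and> s' 40 = VReal (power_sum p t))"
  unfolding setup_prog_def run_Seq run_Assign
proof (rule run_call[OF run_read_unary[where n = n]], goal_cases)
  case (5 m s')
  have fr: "s' 2 = VReal p" "s' 3 = V" "s' 4 = enc_list VReal t" "s' 5 = enc_unary n"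
    using 5(2)[of 2] 5(2)[of 3] 5(2)[of 4] 5(2)[of 5] assms by simp_all
  show ?case
    unfolding run_Seq run_Assign
  proof (rule run_For[where f = VReal and xs = t and B = 1
        and Inv = "\<lambda>ys s. s 40 = VReal (power_sum p ys)"], goal_cases)
    case (5 ys a zs u)
    then show ?case using 5(2) 5(3)[of 2] fr by (simp add: power_sum_def)
  next
    case (6 l u)
    then show ?case using 6(1,2) 6(3)[of 2] 6(3)[of 3] 6(3)[of 4] 6(3)[of 5] 6(3)[of 6] fr 5(1)
      by (simp add: emitted_def)
  qed (use fr in \<open>simp_all add: power_sum_def\<close>)
qed (use assms in simp_all)

definition clauses_prog :: "real com" where
  "clauses_prog = (34 ::= Fst (Snd (Var 0)) ;; For 27 34 clause_prog)"

lemma writes_clauses_prog [simp]: "writes clauses_prog = {27, 34} \<union> writes clause_prog"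
  by (auto simp: clauses_prog_def)

fun enc_clause :: "literal list \<times> nat \<Rightarrow> val" where
  "enc_clause (C, w) = VPair (enc_list enc_lit C) (enc_binary w)"

definition clauses_time :: "nat \<Rightarrow> nat \<Rightarrow> nat \<Rightarrow> nat \<Rightarrow> nat \<Rightarrow> nat" where
  "clauses_time m d l k n = 2 + m * (3 + clause_time d l k n)"

lemma run_clauses:
  assumes "emitted p n [] s" "s 31 = VReal 0"
    "s 0 = VPair u (VPair (enc_list enc_clause Cs) u')"
    "s 3 = enc_list (enc_list VReal) V" "s 4 = enc_list VReal t" "length V = length t"
    "\<And>vs. vs \<in> set V \<Longrightarrow> length vs = k"
    "\<And>C w b x. (C, w) \<in> set Cs \<Longrightarrow> length C = k \<and> length (bits w) \<le> l"
    "\<And>C w b x. (C, w) \<in> set Cs \<Longrightarrow> (b, x) \<in> set C \<Longrightarrow> x \<le> n"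
  shows "run clauses_prog s (\<lambda>m s'. m \<le> clauses_time (length Cs) (length t) l k n \<and>
     emitted p n (concat (map (clause_gadgets V t) Cs)) s' \<and> s' 31 = VReal (real (\<Sum>(C, w)\<leftarrow>Cs. w)))"
  unfolding clauses_prog_def run_Seq run_Assign
proof (rule run_For[where f = enc_clause and xs = Cs and B = "clause_time (length t) l k n" 
        and Inv = "\<lambda>ys s. emitted p n (concat (map (clause_gadgets V t) ys)) s \<and> 
           s 31 = VReal (real (\<Sum>(C, w)\<leftarrow>ys. w))"], goal_cases)
  case (5 ys a zs u)
  obtain C w where a: "a = (C, w)" by (cases a)
  have Cw: "(C, w) \<in> set Cs" by (simp add: 5(1) a)
  show ?case 
  proof (rule run_call[OF run_clause[where C = C and w = w and n = n and p = p and V = V and t = t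
            and T = "real (\<Sum>(C, w)\<leftarrow>ys. w)"
            and G = "concat (map (clause_gadgets V t) ys)" and k = k and l = l]], goal_cases)
    case 1
    then show ?case using 5(2) by (simp add: emitted_def)
  next
    case 9
    then show ?case by (rule assms(9)[OF Cw])
  next
    case 11
    then show ?case by (simp add: a)
  qed (use assms 5(2) 5(3)[of 3] 5(3)[of 4] Cw in \<open>simp_all add: a\<close>)
next
  case (6 m s')
  then show ?case by (simp add: clauses_time_def)
qed (use assms in \<open>simp_all add: emitted_def\<close>)

section \<open>Rows of the variables and the last row\<close>

definition unit_gadget :: "real \<Rightarrow> nat \<Rightarrow> gadget" where
  "unit_gadget \<alpha> y = (\<alpha>, [(True, y)], [2], 1)"

text \<open>Variable 37 counts the variables in unary, so that variable 10 receives the encoding of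
  the clause whose only literal is the current variable, positive.\<close>

definition finish_prog :: "real com" where
  "finish_prog = (29 ::= Snd (Snd (Var 0)) ;; read_binary ;; 35 ::= Var 9 ;;
     36 ::= Const 1 \<^bold>+ Var 31 \<^bold>* Var 40 ;; 37 ::= ENil ;; 38 ::= Var 5 ;; 9 ::= Var 36 ;;
     11 ::= EPair (Const 1 \<^bold>+ Const 1) ENil ;; 12 ::= Const 1 ;;
     For 39 38 (10 ::= EPair (EPair (EPair ENil ENil) (Var 37)) ENil ;; emit_prog ;;
       37 ::= EPair ENil (Var 37)) ;;
     9 ::= Var 35 \<^bold>* Var 40 \<^bold>+ Const 1 ;; 10 ::= ENil ;; 11 ::= ENil ;; emit_prog ;;
     0 ::= EPair (Var 7) (EPair (Var 8)
       ((Var 35 \<^bold>+ (Var 6 \<^bold>+ Const 1) \<^bold>* Var 36) \<^bold>^ (Const 1 \<^bold>/ Var 2))))"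

definition finish_time :: "nat \<Rightarrow> nat \<Rightarrow> nat \<Rightarrow> nat" where
  "finish_time l k n = 17 + 6 * l + emit_time k n + n * (5 + emit_time k n)"

lemma run_finish:
  fixes n W :: nat and \<tau> T :: real and G :: "gadget list"
  defines "\<alpha> \<equiv> 1 + T * \<tau>"
  defines "G' \<equiv> G @ map (unit_gadget \<alpha>) [0..<n] @ [(real W * \<tau> + 1, [], [], 1)]"
  assumes "emitted p n G s" "s 31 = VReal T" "s 40 = VReal \<tau>" "s 0 = VPair u (VPair u' (enc_binary W))"
    "k \<ge> 1" "length (bits W) \<le> l"
  shows "run finish_prog s (\<lambda>m s'. m \<le> finish_time l k n \<and>
     s' 0 = VPair (enc_list (enc_list VReal) (map (gadget_row p n) (rev G')))
       (VPair (enc_list VReal (map (gadget_target p) (rev G')))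
         (VReal ((real W + (real n + 1) * \<alpha>) powr (1 / p)))))"
  unfolding finish_prog_def run_Seq run_Assign
proof (rule run_call[OF run_read_binary[where w = W]], goal_cases)
  case (2 m s')
  have fr: "s' x = s x" if "x \<notin> {9, 28, 29, 30}" for x
    using 2(2)[of x] that by simp
  note h = assms(3)[unfolded emitted_def]
  show ?case
    unfolding run_Seq run_Assign
  proof (rule run_For[where f = "\<lambda>_. VNil" and xs = "[0..<n]" and B = "2 + emit_time k n" 
        and Inv = "\<lambda>ys s. emitted p n (G @ map (unit_gadget \<alpha>) [0..<length ys]) s \<and>
            s 37 = enc_unary (length ys)"], goal_cases)
    case (5 ys a zs u)
    have len: "length ys < n"
      using arg_cong[OF 5(1), of length] by simp
    have u: "u 9 = VReal \<alpha>" "u 11 = enc_list VReal [2]" "u 12 = VReal 1"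
      using 5(3)[of 9] 5(3)[of 11] 5(3)[of 12] fr[of 31] fr[of 40] assms(4,5) 2(1)
      by (simp_all add: \<alpha>_def)
    show ?case unfolding run_Seq run_Assign
    proof (rule run_call[OF run_emit[where C = "[(True, length ys)]" and vs = "[2]" and b = 1 and w = \<alpha>
            and n = n and p = p and G = "G @ map (unit_gadget \<alpha>) [0..<length ys]" and k = k]], goal_cases)
      case (9 m u')
      then show ?case using 9(2)[of 37] 5(2) by (simp add: unit_gadget_def emitted_def)
    next
      case 1
      then show ?case using 5(2) by (simp add: emitted_def)
    qed (use assms(7) 5(2) u len in \<open>simp_all add: enc_bool_def\<close>)
  next
    case (6 l' u)
    have u: "u 35 = VReal (real W)" "u 36 = VReal \<alpha>" "u 40 = VReal \<tau>" "u 12 = VReal 1"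
      using 6(3)[of 35] 6(3)[of 36] 6(3)[of 40] 6(3)[of 12] fr[of 40] fr[of 31] assms(4,5) 2(1)
      by (simp_all add: \<alpha>_def)
    let ?G = "G @ map (unit_gadget \<alpha>) [0..<n]"
    have hu: "emitted p n ?G u" using 6(1) by simp
    show ?case unfolding run_Seq run_Assign
    proof (rule run_call[OF run_emit[where C = "[]" and vs = "[]" and b = 1 and w = "real W * \<tau> + 1"
            and n = n and p = p and G = ?G and k = k]], goal_cases)
      case 1
      then show ?case using hu by (simp add: emitted_def)
    next
      case (9 m' u')
      have "u' 35 = VReal (real W)" "u' 36 = VReal \<alpha>"
        using 9(2)[of 35] 9(2)[of 36] u by simp_all
      moreover have "emitted p n G' u'" using 9(1) by (simp add: G'_def)
      ultimately show ?case using 6(2) 9(1) 2(1) assms(8) by (simp add: emitted_def finish_time_def)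
    qed (use u in simp_all)
  next
    case 2
    then show ?case using h fr[of 2] fr[of 5] fr[of 6] fr[of 7] fr[of 8]
      by (simp add: emitted_def)
  qed (use h fr[of 5] in \<open>simp_all add: enc_unary_def\<close>)
qed (use assms in simp_all)

section \<open>The program after the parallelepiped is known\<close>

definition post_prog :: "real com" where
  "post_prog = (setup_prog ;; clauses_prog ;; finish_prog)"

definition gadgets :: "nat \<Rightarrow> real \<Rightarrow> real list list \<Rightarrow> real list \<Rightarrow> (literal list \<times> nat) list \<Rightarrow> nat \<Rightarrow> gadget list" where
  "gadgets n \<tau> V t Cs W = concat (map (clause_gadgets V t) Cs) @
     map (unit_gadget (1 + real (\<Sum>(C, w)\<leftarrow>Cs. w) * \<tau>)) [0..<n] @ [(real W * \<tau> + 1, [], [], 1)]"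

text \<open>Its \<open>p\<close>-th power is the cost of an assignment of satisfied weight exactly
  \<open>W\<close>: the \<open>W * \<tau>\<close> of the last row cancels the
  \<open>- W * \<tau>\<close> of the unsatisfied weight, and \<open>1 + T * \<tau>\<close> supplies
  one more \<alpha>.\<close>

definition radius :: "real \<Rightarrow> nat \<Rightarrow> real \<Rightarrow> (literal list \<times> nat) list \<Rightarrow> nat \<Rightarrow> real" where
  "radius p n \<tau> Cs W = (real W + (real n + 1) * (1 + real (\<Sum>(C, w)\<leftarrow>Cs. w) * \<tau>)) powr (1 / p)"

definition post_time :: "nat \<Rightarrow> nat \<Rightarrow> nat \<Rightarrow> nat \<Rightarrow> nat \<Rightarrow> nat" where
  "post_time m d l k n = 13 + 4 * n + 4 * d + clauses_time m d l k n + finish_time l k n"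

lemma run_post:
  fixes n W :: nat and V :: "real list list" and t :: "real list" and Cs :: "(literal list \<times> nat) list"
  defines "G \<equiv> \<lambda>\<tau>. gadgets n \<tau> V t Cs W"
  assumes "s 0 = VPair (enc_unary n) (VPair (enc_list enc_clause Cs) (enc_binary W))"
    "s 50 = VPair (VReal p) (VPair (enc_list (enc_list VReal) V) (enc_list VReal t))"
    "length V = length t" "\<And>vs. vs \<in> set V \<Longrightarrow> length vs = k"
    "\<And>C w b x. (C, w) \<in> set Cs \<Longrightarrow> length C = k \<and> length (bits w) \<le> l"
    "\<And>C w b x. (C, w) \<in> set Cs \<Longrightarrow> (b, x) \<in> set C \<Longrightarrow> x \<le> n"
    "k \<ge> 1" "length (bits W) \<le> l"
  shows "run post_prog s (\<lambda>m s'. m \<le> post_time (length Cs) (length t) l k n \<and>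
     s' 0 = VPair (enc_list (enc_list VReal) (map (gadget_row p n) (rev (G (power_sum p t)))))
       (VPair (enc_list VReal (map (gadget_target p) (rev (G (power_sum p t)))))
         (VReal (radius p n (power_sum p t) Cs W))))"
  unfolding post_prog_def run_Seq
proof (rule run_call[OF run_setup[where n = n and p = p and t = t and V = "enc_list (enc_list VReal) V"
        and v = "VPair (enc_list enc_clause Cs) (enc_binary W)"]], goal_cases)
  case (3 m1 s1)
  have s1: "s1 0 = VPair (enc_unary n) (VPair (enc_list enc_clause Cs) (enc_binary W))"
    using 3(2)[of 0] assms(2) by simp
  show ?case
  proof (rule run_call[OF run_clauses[where u = "enc_unary n" and u' = "enc_binary W" and V = V and t = t and Cs = Cs and p = p and n = n and k = k and l = l]], goal_cases)
    case (10 m2 s2)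
    have "s2 0 = s1 0" "s2 40 = s1 40" using 10(2)[of 0] 10(2)[of 40] by simp_all
    then show ?case using 10(1) 3(1) s1 assms
      by (intro run_mono[OF run_finish[where G = "concat (map (clause_gadgets V t) Cs)"
             and T = "real (\<Sum>(C, w)\<leftarrow>Cs. w)" and n = n and p = p and W = W and \<tau> = "power_sum p t" and k = k and l = l]])
         (auto simp: post_time_def gadgets_def radius_def)
  qed (use 3 s1 assms in simp_all)
qed (use assms in simp_all)

section \<open>Correctness of the reduction\<close>

lemma square_powr_half: "(x * x) powr (p / 2) = \<bar>x\<bar> powr p" for x p :: real
proof (cases "x = 0")
  case False
  then have "x * x = \<bar>x\<bar> powr 2" by (simp add: powr_numeral power2_eq_square)
  then show ?thesis by (simp only: powr_powr) simp
qed simp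

lemma power_sum_list_of_vec: "power_sum p (list_of_vec t) = (\<Sum>i<dim_vec t. \<bar>t $ i\<bar> powr p)"
  by (simp add: power_sum_def square_powr_half sum_list_sum_nth atLeast0LessThan)

fun lit_val :: "(nat \<Rightarrow> real) \<Rightarrow> literal \<Rightarrow> real" where
  "lit_val z (s, x) = (if s then z x else 1 - z x)"

text \<open>The contribution of a row to the \<open>p\<close>-th power of the distance, expressed by
  literals instead of columns.\<close>

fun cost :: "real \<Rightarrow> (nat \<Rightarrow> real) \<Rightarrow> gadget \<Rightarrow> real" where
  "cost p z (w, C, vs, b) = w * \<bar>(\<Sum>(l, v)\<leftarrow>zip C vs. lit_val z l * v) - b\<bar> powr p"

text \<open>Regroups a sum over literals by variables. A literal \<open>1 - z\<close> with
  coefficient \<open>v\<close> gives \<open>- v\<close> to its column and the constant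
  \<open>v\<close> to \<open>negated_sum\<close>.\<close>

lemma sum_coef:
  assumes "\<And>b x. (b, x) \<in> set C \<Longrightarrow> x < n"
  shows "(\<Sum>y<n. coef y C vs * z y) + negated_sum C vs = (\<Sum>(l, v)\<leftarrow>zip C vs. lit_val z l * v)"
  using assms
proof (induction C arbitrary: vs)
  case Nil
  then show ?case by (simp add: coef_def negated_sum_def)
next
  case (Cons l C)
  obtain s x where l: "l = (s, x)" by (cases l)
  show ?case
  proof (cases vs)
    case Nil
    then show ?thesis by (simp add: coef_def negated_sum_def)
  next
    case (Cons v vs')
    have x: "x < n" using Cons.prems l by auto
    have "(\<Sum>y<n. coef y (l # C) vs * z y) =
        (\<Sum>y<n. (if x = y then (if s then v else - v) * z y else 0) + coef y C vs' * z y)"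
      by (intro sum.cong) (auto simp: coef_def l Cons algebra_simps)
    also have "\<dots> = (if s then v else - v) * z x + (\<Sum>y<n. coef y C vs' * z y)"
      unfolding sum.distrib using x by simp
    finally show ?thesis using Cons.IH[of vs'] Cons.prems
      by (auto simp: negated_sum_def l Cons algebra_simps)
  qed
qed

section \<open>The distance to the target as a sum of costs\<close>

definition basis_mat :: "real \<Rightarrow> nat \<Rightarrow> gadget list \<Rightarrow> real mat" where
  "basis_mat p n G = mat_of_rows_list n (map (gadget_row p n) (rev G))"

definition target_vec :: "real \<Rightarrow> gadget list \<Rightarrow> real vec" where
  "target_vec p G = vec_of_list (map (gadget_target p) (rev G))"

lemma dim_basis_mat [simp]: "dim_row (basis_mat p n G) = length G" "dim_col (basis_mat p n G) = n"
  by (simp_all add: basis_mat_def mat_of_rows_list_def)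

lemma dim_target_vec [simp]: "dim_vec (target_vec p G) = length G"
  by (simp add: target_vec_def)

lemma basis_mat_mult:
  assumes "z \<in> carrier_vec n" "i < length G" "rev G ! i = (w, C, vs, b)"
  shows "(basis_mat p n G *\<^sub>v z) $ i = w powr (1 / p) * (\<Sum>y<n. coef y C vs * z $ y)"
proof -
  have "(basis_mat p n G *\<^sub>v z) $ i = (\<Sum>y<n. basis_mat p n G $$ (i, y) * z $ y)"
    using assms by (simp add: scalar_prod_def atLeast0LessThan)
  also have "\<dots> = (\<Sum>y<n. w powr (1 / p) * (coef y C vs * z $ y))"
    using assms by (intro sum.cong) (simp_all add: basis_mat_def mat_of_rows_list_def)
  finally show ?thesis by (simp add: sum_distrib_left)
qed

text \<open>In each coordinate the factor \<open>w powr (1 / p)\<close> turns into \<open>w\<close>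
  under the \<open>p\<close>-th power, and subtracting the target restores the constants of the
  negative literals. The order of the rows does not affect the sum.\<close>

lemma lp_norm_residual:
  assumes "p \<ge> 1" "z \<in> carrier_vec n"
    and "\<And>w C vs b. (w, C, vs, b) \<in> set G \<Longrightarrow> 0 \<le> w \<and> (\<forall>(s, x) \<in> set C. x < n)"
  shows "lp_norm p (basis_mat p n G *\<^sub>v z - target_vec p G) = (\<Sum>g\<leftarrow>G. cost p (($) z) g) powr (1 / p)"
proof -
  have "\<bar>(basis_mat p n G *\<^sub>v z - target_vec p G) $ i\<bar> powr p = cost p (($) z) (rev G ! i)"
    if i: "i < length G" for i
  proof -
    obtain w C vs b where g: "rev G ! i = (w, C, vs, b)" by (metis prod_cases4)
    have "(w, C, vs, b) \<in> set G" using i g by (metis length_rev nth_mem set_rev)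
    from assms(3)[OF this] have w: "0 \<le> w" and C: "\<And>s x. (s, x) \<in> set C \<Longrightarrow> x < n" by auto
    have "(basis_mat p n G *\<^sub>v z - target_vec p G) $ i =
        w powr (1 / p) * (\<Sum>y<n. coef y C vs * z $ y) - w powr (1 / p) * (b - negated_sum C vs)"
      using i basis_mat_mult[OF assms(2) i g] g by (simp add: target_vec_def vec_of_list_index)
    also have "\<dots> = w powr (1 / p) * ((\<Sum>(l, v)\<leftarrow>zip C vs. lit_val (($) z) l * v) - b)"
    proof -
      have "(\<Sum>(l, v)\<leftarrow>zip C vs. lit_val (($) z) l * v) = (\<Sum>y<n. coef y C vs * z $ y) + negated_sum C vs"
        by (rule sum_coef[symmetric]) (rule C)
      then show ?thesis by (simp only:) (simp add: algebra_simps)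
    qed
    finally show ?thesis
      using g w assms(1) by (simp add: abs_mult powr_mult powr_powr)
  qed
  then have "(\<Sum>i<length G. \<bar>(basis_mat p n G *\<^sub>v z - target_vec p G) $ i\<bar> powr p)
      = (\<Sum>i<length G. cost p (($) z) (rev G ! i))"
    by (intro sum.cong) auto
  also have "\<dots> = (\<Sum>g\<leftarrow>rev G. cost p (($) z) g)"
    by (simp add: sum_list_sum_nth atLeast0LessThan)
  also have "\<dots> = (\<Sum>g\<leftarrow>G. cost p (($) z) g)"
    by (simp add: rev_map[symmetric] sum_list_rev)
  finally show ?thesis by (simp add: lp_norm_def)
qed

section \<open>Costs of clauses\<close>

lemma clause_cost:
  assumes "dim_col V = k" "dim_vec t = dim_row V" "length C = k"
  shows "(\<Sum>g\<leftarrow>clause_gadgets (mat_to_list V) (list_of_vec t) (C, w). cost p z g) =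
    real w * (\<Sum>i<dim_vec t. \<bar>(V *\<^sub>v vec k (\<lambda>j. lit_val z (C ! j)) - t) $ i\<bar> powr p)"
proof -
  let ?u = "vec k (\<lambda>j. lit_val z (C ! j))"
  let ?row = "\<lambda>i. map (\<lambda>j. V $$ (i, j)) [0..<k]"
  have z: "zip (mat_to_list V) (list_of_vec t) = map (\<lambda>i. (?row i, t $ i)) [0..<dim_row V]"
    using assms by (intro nth_equalityI) (simp_all add: mat_to_list_def)
  \<comment> \<open>All rows of a clause read the same vector \<open>?u\<close> of literal values,
    so together they form one residual of the parallelepiped.\<close>
  have r: "(\<Sum>(l, v)\<leftarrow>zip C (?row i). lit_val z l * v) = (V *\<^sub>v ?u) $ i" if "i < dim_row V" for i
  proof -
    have "(\<Sum>(l, v)\<leftarrow>zip C (?row i). lit_val z l * v) = (\<Sum>j<k. lit_val z (C ! j) * V $$ (i, j))"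
      using assms by (simp add: sum_list_sum_nth atLeast0LessThan)
    also have "\<dots> = (V *\<^sub>v ?u) $ i"
      using that assms by (simp add: scalar_prod_def atLeast0LessThan mult.commute)
    finally show ?thesis .
  qed
  have "(\<Sum>g\<leftarrow>clause_gadgets (mat_to_list V) (list_of_vec t) (C, w). cost p z g) =
      (\<Sum>i<dim_row V. real w * \<bar>(\<Sum>(l, v)\<leftarrow>zip C (?row i). lit_val z l * v) - t $ i\<bar> powr p)"
    by (simp add: clause_gadgets_def z comp_def interv_sum_list_conv_sum_set_nat atLeast0LessThan)
  also have "\<dots> = (\<Sum>i<dim_vec t. real w * \<bar>(V *\<^sub>v ?u - t) $ i\<bar> powr p)"
    using assms r by (intro sum.cong) auto
  finally show ?thesis by (simp add: sum_distrib_left)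
qed

text \<open>The literal values form a 0/1 vector that is zero exactly if no literal holds. Away from
  zero the isolating property gives distance 1; at zero the distance is the norm of
  \<open>t\<close>.\<close>

lemma clause_cost_binary:
  assumes iso: "isolating_parallelepiped p k V t" and p: "p \<ge> 1" and len: "length C = k"
  shows "(\<Sum>g\<leftarrow>clause_gadgets (mat_to_list V) (list_of_vec t) (C, w). cost p (\<lambda>x. of_bool (a x)) g) =
    real w * (if sat_clause a C then 1 else power_sum p (list_of_vec t))"
proof -
  let ?u = "vec k (\<lambda>j. lit_val (\<lambda>x. of_bool (a x)) (C ! j))"
  let ?N = "\<lambda>v. \<Sum>i<dim_vec v. \<bar>v $ i\<bar> powr p"
  have dim: "dim_col V = k" "dim_vec t = dim_row V" using iso by (auto simp: isolating_parallelepiped_def)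
  have lit: "lit_val (\<lambda>x. of_bool (a x)) l = of_bool (a (snd l) = fst l)" for l
    by (cases l) auto
  have sat: "sat_clause a C \<longleftrightarrow> ?u \<noteq> 0\<^sub>v k"
  proof -
    have "sat_clause a C \<longleftrightarrow> (\<exists>l\<in>set C. a (snd l) = fst l)"
      unfolding sat_clause_def by (rule bex_cong) auto
    also have "\<dots> \<longleftrightarrow> (\<exists>j<k. a (snd (C ! j)) = fst (C ! j))"
      using len by (metis in_set_conv_nth)
    also have "\<dots> \<longleftrightarrow> ?u \<noteq> 0\<^sub>v k"
      by (auto simp: vec_eq_iff lit)
    finally show ?thesis .
  qed
  have "?N (V *\<^sub>v ?u - t) = (if sat_clause a C then 1 else power_sum p (list_of_vec t))"
  proof (cases "sat_clause a C")
    case True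
    then have "lp_norm p (V *\<^sub>v ?u - t) = 1"
    proof -
      have "?u \<in> carrier_vec k" "\<forall>i<k. ?u $ i \<in> {0, 1}" by (auto simp: lit)
      then show ?thesis using iso True sat unfolding isolating_parallelepiped_def by blast
    qed
    then have "?N (V *\<^sub>v ?u - t) powr (1 / p) = 1" by (simp add: lp_norm_def)
    then have "(?N (V *\<^sub>v ?u - t) powr (1 / p)) powr p = 1" by simp
    then show ?thesis using True p by (simp add: powr_powr sum_nonneg)
  next
    case False
    then have "?u = 0\<^sub>v k" using sat by blast
    moreover have "\<bar>(V *\<^sub>v 0\<^sub>v k - t) $ i\<bar> = \<bar>t $ i\<bar>" if "i < dim_vec t" for i
      using that dim by (simp add: scalar_prod_def)
    ultimately show ?thesis using False by (simp add: power_sum_list_of_vec)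
  qed
  then show ?thesis using clause_cost[OF dim len] by simp
qed

lemma power_sum_gt_1:
  assumes "isolating_parallelepiped p k V t" "p \<ge> 1"
  shows "power_sum p (list_of_vec t) > 1"
proof -
  let ?\<tau> = "power_sum p (list_of_vec t)"
  have "1 < lp_norm p t" using assms(1) by (simp add: isolating_parallelepiped_def)
  then have gt: "1 < ?\<tau> powr (1 / p)" by (simp add: lp_norm_def power_sum_list_of_vec)
  have nn: "0 \<le> ?\<tau>" by (simp add: power_sum_list_of_vec sum_nonneg)
  show ?thesis
  proof (rule ccontr)
    assume "\<not> ?thesis"
    then have "?\<tau> powr (1 / p) \<le> 1 powr (1 / p)" using nn assms(2) by (intro powr_mono2) auto
    then show False using gt by simp
  qed
qed

text \<open>Vector entries are specified only below the dimension, so two valuations can be compared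
  only on variables that occur.\<close>

lemma cost_cong:
  assumes "\<And>s x. (s, x) \<in> set C \<Longrightarrow> z x = z' x"
  shows "cost p z (w, C, vs, b) = cost p z' (w, C, vs, b)"
proof -
  have "lit_val z l = lit_val z' l" if "l \<in> set C" for l
    using assms that by (cases l) auto
  then have "map (\<lambda>(l, v). lit_val z l * v) (zip C vs) = map (\<lambda>(l, v). lit_val z' l * v) (zip C vs)"
    by (auto dest: set_zip_leftD)
  then show ?thesis by (simp only: cost.simps)
qed

lemma cost_unit_gadget: "cost p z (unit_gadget \<alpha> y) = \<alpha> * \<bar>2 * z y - 1\<bar> powr p"
  by (simp add: unit_gadget_def mult.commute)

section \<open>Total cost of all gadgets\<close>

lemma cost_gadgets:
  fixes Cs :: "(literal list \<times> nat) list" and \<tau> :: real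
  defines "\<alpha> \<equiv> 1 + real (\<Sum>(C, w)\<leftarrow>Cs. w) * \<tau>"
  assumes "\<tau> \<ge> 0"
  shows "(\<Sum>g\<leftarrow>gadgets n \<tau> V t Cs W. cost p z g) =
    (\<Sum>c\<leftarrow>Cs. \<Sum>g\<leftarrow>clause_gadgets V t c. cost p z g) +
    (\<Sum>y<n. \<alpha> * \<bar>2 * z y - 1\<bar> powr p) + (real W * \<tau> + 1)"
proof -
  have "(\<Sum>g\<leftarrow>concat (map f xs). cost p z g) = (\<Sum>c\<leftarrow>xs. \<Sum>g\<leftarrow>f c. cost p z g)"
    for f and xs :: "(literal list \<times> nat) list"
    by (induction xs) auto
  then show ?thesis
    by (simp add: gadgets_def \<alpha>_def[symmetric] comp_def cost_unit_gadget
        interv_sum_list_conv_sum_set_nat atLeast0LessThan)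
qed

lemma cost_gadgets_binary:
  fixes Cs :: "(literal list \<times> nat) list" and V :: "real mat" and t :: "real vec" and p :: real and a :: "nat \<Rightarrow> bool"
  defines "\<tau> \<equiv> power_sum p (list_of_vec t)" and "T \<equiv> real (\<Sum>(C, w)\<leftarrow>Cs. w)"
    and "S \<equiv> real (\<Sum>(C, w)\<leftarrow>Cs. if sat_clause a C then w else 0)"
  assumes iso: "isolating_parallelepiped p k V t" and p: "p \<ge> 1"
    and len: "\<And>C w. (C, w) \<in> set Cs \<Longrightarrow> length C = k"
    and z: "\<And>y. y < n \<Longrightarrow> z y = of_bool (a y)" 
    and vars: "\<And>C w s x. (C, w) \<in> set Cs \<Longrightarrow> (s, x) \<in> set C \<Longrightarrow> x < n"
  shows "(\<Sum>g\<leftarrow>gadgets n \<tau> (mat_to_list V) (list_of_vec t) Cs W. cost p z g) =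
    S + (T - S) * \<tau> + real n * (1 + T * \<tau>) + (real W * \<tau> + 1)"
proof -
  have "\<tau> \<ge> 0" using power_sum_gt_1[OF iso p] by (simp add: \<tau>_def)
  have c: "cost p z g = cost p (\<lambda>x. of_bool (a x)) g"
    if cs: "c \<in> set Cs" and gs: "g \<in> set (clause_gadgets (mat_to_list V) (list_of_vec t) c)" for c g
  proof -
    obtain C w where cw: "c = (C, w)" by (cases c)
    obtain vs b where g: "g = (real w, C, vs, b)" using gs by (auto simp: clause_gadgets_def cw)
    show ?thesis unfolding g using vars[of C w] cs cw z by (intro cost_cong) auto
  qed
  have "(\<Sum>c\<leftarrow>Cs. \<Sum>g\<leftarrow>clause_gadgets (mat_to_list V) (list_of_vec t) c. cost p z g) =
      (\<Sum>c\<leftarrow>Cs. \<Sum>g\<leftarrow>clause_gadgets (mat_to_list V) (list_of_vec t) c. cost p (\<lambda>x. of_bool (a x)) g)"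
    using c by (intro arg_cong[where f = sum_list] map_cong refl) auto
  also have "\<dots> = S + (T - S) * \<tau>"
    unfolding S_def T_def using len
  proof (induction Cs)
    case (Cons c Cs)
    obtain C w where c: "c = (C, w)" by (cases c)
    have "(\<Sum>g\<leftarrow>clause_gadgets (mat_to_list V) (list_of_vec t) c. cost p (\<lambda>x. of_bool (a x)) g) =
        real w * (if sat_clause a C then 1 else \<tau>)"
      unfolding c \<tau>_def using Cons.prems c by (intro clause_cost_binary[OF iso p]) auto
    moreover have "(\<Sum>c\<leftarrow>Cs. \<Sum>g\<leftarrow>clause_gadgets (mat_to_list V) (list_of_vec t) c. cost p (\<lambda>x. of_bool (a x)) g)
        = real (\<Sum>(C, w)\<leftarrow>Cs. if sat_clause a C then w else 0) +
          (real (\<Sum>(C, w)\<leftarrow>Cs. w) - real (\<Sum>(C, w)\<leftarrow>Cs. if sat_clause a C then w else 0)) * \<tau>"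
      using Cons.prems by (intro Cons.IH) auto
    ultimately show ?case by (simp add: c algebra_simps)
  qed simp
  finally have 1: "(\<Sum>c\<leftarrow>Cs. \<Sum>g\<leftarrow>clause_gadgets (mat_to_list V) (list_of_vec t) c. cost p z g) = S + (T - S) * \<tau>" .
  have 2: "(\<Sum>y<n. \<alpha> * \<bar>2 * z y - 1\<bar> powr p) = real n * \<alpha>" for \<alpha>
  proof -
    have "\<bar>2 * z y - 1\<bar> powr p = 1" if "y < n" for y
      using z[OF that] by (cases "a y") auto
    then show ?thesis by simp
  qed
  show ?thesis
    unfolding cost_gadgets[OF \<open>\<tau> \<ge> 0\<close>] 1 2 T_def ..
qed

text \<open>The clauses are estimated by 0. For an integer \<open>z\<close>, the number
  \<open>\<bar>2 * z - 1\<bar>\<close> is at least 1, and at least 3 outside 0 and 1; an exponent of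
  at least 1 keeps both bounds. One variable thus costs three times \<alpha> and the others at least
  \<alpha> each.\<close>

lemma cost_gadgets_nonbinary:
  fixes Cs :: "(literal list \<times> nat) list" and z :: "nat \<Rightarrow> int"
  assumes "\<tau> \<ge> 0" "p \<ge> 1" "y < n" "z y \<notin> {0, 1}"
  shows "(\<Sum>g\<leftarrow>gadgets n \<tau> V t Cs W. cost p (\<lambda>x. real_of_int (z x)) g) \<ge>
    real W * \<tau> + 1 + (real n + 2) * (1 + real (\<Sum>(C, w)\<leftarrow>Cs. w) * \<tau>)"
proof -
  let ?z = "\<lambda>x. real_of_int (z x)"
  let ?a = "1 + real (\<Sum>(C, w)\<leftarrow>Cs. w) * \<tau>"
  have a: "?a \<ge> 0" using assms(1) by simp
  have "cost p ?z g \<ge> 0" if "c \<in> set Cs" "g \<in> set (clause_gadgets V t c)" for c g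
    using that by (auto simp: clause_gadgets_def)
  then have 1: "(\<Sum>c\<leftarrow>Cs. \<Sum>g\<leftarrow>clause_gadgets V t c. cost p ?z g) \<ge> 0"
    by (intro sum_list_nonneg) (auto intro!: sum_list_nonneg)
  have odd: "\<bar>2 * ?z x - 1\<bar> powr p \<ge> 1" for x
  proof -
    have "\<bar>2 * z x - 1\<bar> \<ge> 1" by presburger
    then have "\<bar>2 * ?z x - 1\<bar> \<ge> 1" by linarith
    then show ?thesis using assms(2) by (simp add: ge_one_powr_ge_zero)
  qed
  have big: "\<bar>2 * ?z y - 1\<bar> powr p \<ge> 3"
  proof -
    have "\<bar>2 * z y - 1\<bar> \<ge> 3" using assms(4) by auto
    then have "\<bar>2 * ?z y - 1\<bar> \<ge> 3" by linarith
    then have "3 powr 1 \<le> \<bar>2 * ?z y - 1\<bar> powr p" using assms(2) by (intro powr_mono_both) auto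
    then show ?thesis by simp
  qed
  have "(real n + 2) * ?a = (\<Sum>x<n. ?a * (1 + (if x = y then 2 else 0)))"
    using assms(3) unfolding sum_distrib_left[symmetric] sum.distrib by (simp add: mult.commute)
  also have "\<dots> \<le> (\<Sum>x<n. ?a * \<bar>2 * ?z x - 1\<bar> powr p)"
    using odd big a by (intro sum_mono mult_left_mono) auto
  finally show ?thesis
    unfolding cost_gadgets[OF assms(1)] using 1 by linarith
qed

section \<open>Linear independence of the columns\<close>

lemma lin_indep_colsI:
  fixes B :: "real mat"
  assumes "\<And>v. v \<in> carrier_vec (dim_col B) \<Longrightarrow> B *\<^sub>v v = 0\<^sub>v (dim_row B) \<Longrightarrow> v = 0\<^sub>v (dim_col B)"
  shows "lin_indep_cols B"
proof -
  have "distinct (cols B)"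
  proof (rule ccontr)
    assume "\<not> distinct (cols B)"
    then obtain i j where ij: "i < dim_col B" "j < dim_col B" "i \<noteq> j" "col B i = col B j"
      unfolding distinct_conv_nth by auto
    \<comment> \<open>If columns \<open>i\<close> and \<open>j\<close> agree, the difference of the
      two unit vectors lies in the kernel.\<close>
    define v :: "real vec" where "v = unit_vec (dim_col B) i - unit_vec (dim_col B) j"
    have "B *\<^sub>v v = B *\<^sub>v unit_vec (dim_col B) i - B *\<^sub>v unit_vec (dim_col B) j"
      unfolding v_def by (rule mult_minus_distrib_mat_vec[of _ "dim_row B" "dim_col B"]) auto
    also have "\<dots> = col B i - col B j"
      using ij(1,2) by (intro eq_vecI) (auto simp: scalar_prod_right_unit)
    finally have "v = 0\<^sub>v (dim_col B)" using ij by (intro assms) (auto simp: v_def)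
    then have "v $ i = 0" using ij by simp
    then show False using ij by (simp add: v_def)
  qed
  \<comment> \<open>A linear dependence of the columns would likewise give a nonzero kernel
    vector.\<close>
  then show ?thesis
    unfolding lin_indep_cols_def
    using assms vec_space.lin_depE[of B "dim_row B" "dim_col B"] by blast
qed

lemma gadgets_wf:
  assumes "(w, C, vs, b) \<in> set (gadgets n \<tau> V t Cs W)" "\<tau> \<ge> 0"
    and "\<And>C w s x. (C, w) \<in> set Cs \<Longrightarrow> (s, x) \<in> set C \<Longrightarrow> x < n"
  shows "0 \<le> w \<and> (\<forall>(s, x) \<in> set C. x < n)"
  using assms by (fastforce simp: gadgets_def clause_gadgets_def unit_gadget_def)

lemma lp_norm_residual_int:
  fixes z :: "int vec"
  assumes "p \<ge> 1" "z \<in> carrier_vec n"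
    and G: "\<And>w C vs b. (w, C, vs, b) \<in> set G \<Longrightarrow> 0 \<le> w \<and> (\<forall>(s, x) \<in> set C. x < n)"
  shows "lp_norm p (basis_mat p n G *\<^sub>v map_vec of_int z - target_vec p G) =
    (\<Sum>g\<leftarrow>G. cost p (\<lambda>x. real_of_int (z $ x)) g) powr (1 / p)"
proof -
  have "cost p (($) (map_vec of_int z)) g = cost p (\<lambda>x. real_of_int (z $ x)) g" if g: "g \<in> set G" for g
  proof -
    obtain w C vs b where "g = (w, C, vs, b)" by (metis prod_cases4)
    then show ?thesis using G[of w C vs b] g assms(2) by (auto intro!: cost_cong simp del: cost.simps)
  qed
  then have "(\<Sum>g\<leftarrow>G. cost p (($) (map_vec of_int z)) g) = (\<Sum>g\<leftarrow>G. cost p (\<lambda>x. real_of_int (z $ x)) g)"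
    by (metis (no_types, lifting) map_cong)
  then show ?thesis
    using lp_norm_residual[OF assms(1) _ G, of "map_vec of_int z"] assms(2) by simp
qed

text \<open>The row of variable \<open>y\<close> is nonzero only in column \<open>y\<close>, so a
  kernel vector vanishes there.\<close>

lemma basis_mat_lin_indep:
  assumes "\<And>y. y < n \<Longrightarrow> unit_gadget \<alpha> y \<in> set G" "\<alpha> > 0"
  shows "lin_indep_cols (basis_mat p n G)"
proof (rule lin_indep_colsI)
  fix v assume "v \<in> carrier_vec (dim_col (basis_mat p n G))"
    and B: "basis_mat p n G *\<^sub>v v = 0\<^sub>v (dim_row (basis_mat p n G))"
  then have v: "v \<in> carrier_vec n" by simp
  have "v $ y = 0" if y: "y < n" for y
  proof -
    have "unit_gadget \<alpha> y \<in> set (rev G)" using assms(1)[OF y] by simp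
    then obtain i where i: "i < length G" "rev G ! i = unit_gadget \<alpha> y"
      by (metis in_set_conv_nth length_rev)
    have "0 = \<alpha> powr (1 / p) * (\<Sum>y'<n. coef y' [(True, y)] [2] * v $ y')"
      using basis_mat_mult[OF v i(1) i(2)[unfolded unit_gadget_def], of p] B i(1) by simp
    also have "(\<Sum>y'<n. coef y' [(True, y)] [2] * v $ y') = (\<Sum>y'<n. if y' = y then 2 * v $ y else 0)"
      by (intro sum.cong) (auto simp: coef_def)
    finally show ?thesis using y assms(2) by simp
  qed
  then show "v = 0\<^sub>v (dim_col (basis_mat p n G))" using v by (intro eq_vecI) auto
qed

section \<open>Equivalence of the two instances\<close>

lemma reduction_correct:
  fixes Cs :: "(literal list \<times> nat) list" and V :: "real mat" and t :: "real vec" and p :: real and n W :: nat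
  defines "\<tau> \<equiv> power_sum p (list_of_vec t)"
  defines "G \<equiv> gadgets n \<tau> (mat_to_list V) (list_of_vec t) Cs W"
  defines "inst \<equiv> (basis_mat p n G, target_vec p G, radius p n \<tau> Cs W)"
  assumes iso: "isolating_parallelepiped p k V t" and p: "p \<ge> 1"
    and len: "\<And>C w. (C, w) \<in> set Cs \<Longrightarrow> length C = k"
    and vars: "\<And>C w s x. (C, w) \<in> set Cs \<Longrightarrow> (s, x) \<in> set C \<Longrightarrow> x < n"
  shows "cvp_instance n inst"
    and "cvp_yes p inst \<longleftrightarrow> (\<exists>a. W \<le> (\<Sum>(C, w)\<leftarrow>Cs. if sat_clause a C then w else 0))"
proof -
  have \<tau>: "\<tau> > 1" unfolding \<tau>_def by (rule power_sum_gt_1[OF iso p])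
  define T where "T = real (\<Sum>(C, w)\<leftarrow>Cs. w)"
  define \<alpha> where "\<alpha> = 1 + T * \<tau>"
  define S where "S a = (\<Sum>(C, w)\<leftarrow>Cs. if sat_clause a C then w else 0)" for a
  define R where "R = real W + (real n + 1) * \<alpha>"
  have T: "T \<ge> 0" by (simp add: T_def)
  have "T * \<tau> \<ge> 0" using T \<tau> by simp
  then have \<alpha>: "\<alpha> \<ge> 1" by (simp add: \<alpha>_def)
  have ST: "S a \<le> T" for a
    unfolding S_def T_def of_nat_le_iff by (rule sum_list_mono) auto
  have "unit_gadget \<alpha> y \<in> set G" if "y < n" for y
    using that by (simp add: G_def gadgets_def \<alpha>_def T_def)
  then have "lin_indep_cols (basis_mat p n G)" using \<alpha> by (intro basis_mat_lin_indep) auto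
  moreover have R: "R > 0" using \<alpha> unfolding R_def by (intro add_nonneg_pos mult_pos_pos) auto
  moreover have rad: "radius p n \<tau> Cs W = R powr (1 / p)"
    by (simp add: radius_def R_def \<alpha>_def T_def)
  ultimately show "cvp_instance n inst" by (simp add: inst_def)
  \<comment> \<open>\<open>N z\<close> is the \<open>p\<close>-th power of the distance for integer
    coordinates \<open>z\<close>, and \<open>F s\<close> is its value at a 0/1 vector of satisfied
    weight \<open>s\<close>. Since \<open>\<tau> > 1\<close>, more satisfied weight means a closer
    vector.\<close>
  define N where "N z = (\<Sum>g\<leftarrow>G. cost p (\<lambda>x. real_of_int (z $ x)) g)" for z :: "int vec"
  define F where "F s = s + (T - s) * \<tau> + real n * \<alpha> + (real W * \<tau> + 1)" for s :: real
  have F_anti: "F s \<le> F s' \<longleftrightarrow> s' \<le> s" for s s'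
  proof -
    have "F s' - F s = (\<tau> - 1) * (s - s')" by (simp add: F_def algebra_simps)
    then show ?thesis using \<tau> by (smt (verit) mult_nonneg_nonneg mult_pos_neg)
  qed
  have FR: "F s \<le> R \<longleftrightarrow> W \<le> s" for s
  proof -
    have "F W = R" by (simp add: F_def R_def \<alpha>_def algebra_simps)
    then show ?thesis using F_anti[of s W] by simp
  qed
  have norm: "lp_norm p (basis_mat p n G *\<^sub>v map_vec of_int z - target_vec p G) = N z powr (1 / p)"
    if "z \<in> carrier_vec n" for z
    unfolding N_def G_def
    by (rule lp_norm_residual_int[OF p that]) (use gadgets_wf[OF _ _ vars] \<tau> in fastforce)
  have binary: "N z = F (S a)" if "\<And>y. y < n \<Longrightarrow> z $ y = of_bool (a y)" for z a
    unfolding N_def F_def S_def G_def \<alpha>_def T_def \<tau>_def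
    by (rule cost_gadgets_binary[OF iso p len _ vars]) (use that in auto)
  have binary': "N z = F (S (\<lambda>y. z $ y = 1))" if "\<And>y. y < n \<Longrightarrow> z $ y \<in> {0, 1}" for z
    by (rule binary) (use that in fastforce)
  \<comment> \<open>The first bound excludes the vector from the radius. The second makes it no
    closer than any 0/1 vector, as \<open>cvp_yes\<close> refers to an attained minimum.\<close>
  have nonbinary: "N z > R" "N z \<ge> F s" if "y < n" "z $ y \<notin> {0, 1}" "0 \<le> s" "s \<le> T" for z y s
  proof -
    have *: "N z \<ge> real W * \<tau> + 1 + (real n + 2) * \<alpha>"
      unfolding N_def G_def \<alpha>_def T_def
      by (rule cost_gadgets_nonbinary[where z = "($) z"]) (use that p \<tau> in auto)
    have "real W * 1 \<le> real W * \<tau>" using \<tau> by (intro mult_left_mono) auto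
    then show "N z > R" using * \<alpha> by (simp add: R_def algebra_simps)
    \<comment> \<open>Satisfied weight 0 is the costliest case; its clause cost
      \<open>T * \<tau>\<close> is still below \<alpha>.\<close>
    have "F s \<le> F 0" using that F_anti by simp
    also have "F 0 \<le> real W * \<tau> + 1 + (real n + 2) * \<alpha>"
      using \<alpha> \<open>T * \<tau> \<ge> 0\<close> by (simp add: F_def \<alpha>_def algebra_simps)
    finally show "N z \<ge> F s" using * by simp
  qed
  have N_nonneg: "N z \<ge> 0" for z
    unfolding N_def
  proof (intro sum_list_nonneg, clarsimp simp del: cost.simps)
    fix w C vs b assume "(w, C, vs, b) \<in> set G"
    then have "w \<ge> 0" using gadgets_wf[OF _ _ vars] \<tau> unfolding G_def by fastforce
    then show "0 \<le> cost p (\<lambda>x. real_of_int (z $ x)) (w, C, vs, b)" by simp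
  qed
  \<comment> \<open>Distances and radius are \<open>p\<close>-th roots, so they can be compared
    before taking roots.\<close>
  have mono: "N z powr (1 / p) \<le> r powr (1 / p) \<longleftrightarrow> N z \<le> r" if "r \<ge> 0" for z r
  proof (cases "N z \<le> r")
    case True
    then show ?thesis using N_nonneg[of z] p by (simp add: powr_mono2)
  next
    case False
    then have "r powr (1 / p) < N z powr (1 / p)" using that p by (intro powr_less_mono2) auto
    then show ?thesis using False by simp
  qed
  show "cvp_yes p inst \<longleftrightarrow> (\<exists>a. W \<le> (\<Sum>(C, w)\<leftarrow>Cs. if sat_clause a C then w else 0))"
    unfolding S_def[symmetric]
  proof
    assume "cvp_yes p inst"
    then obtain z where z: "z \<in> carrier_vec n" and
      "lp_norm p (basis_mat p n G *\<^sub>v map_vec of_int z - target_vec p G) \<le> radius p n \<tau> Cs W"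
      by (auto simp: inst_def is_arg_min_def lattice_of_def)
    then have le: "N z \<le> R" using norm[OF z] rad mono[of R z] R by simp
    have "z $ y \<in> {0, 1}" if "y < n" for y
      using nonbinary(1)[OF that, of z 0] le T by force
    then have "F (S (\<lambda>y. z $ y = 1)) \<le> R" using binary' le by metis
    then have "W \<le> S (\<lambda>y. z $ y = 1)" unfolding FR by simp
    then show "\<exists>a. W \<le> S a" by blast
  next
    assume "\<exists>a. W \<le> S a"
    then obtain a0 where a0: "W \<le> S a0" ..
    \<comment> \<open>A minimum has to be exhibited, so an assignment of greatest weight is needed.
      It exists although there are infinitely many assignments, because the total weight bounds
      \<open>S\<close>.\<close>
    have "S a < Suc (\<Sum>(C, w)\<leftarrow>Cs. w)" for a
      using ST[of a] unfolding T_def of_nat_le_iff by simp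
    then obtain a where a: "\<And>b. S b \<le> S a"
      using ex_has_greatest_nat[of "\<lambda>_. True" undefined S] by blast
    define z :: "int vec" where "z = vec n (\<lambda>y. of_bool (a y))"
    have z: "z \<in> carrier_vec n" by (simp add: z_def)
    have Nz: "N z = F (S a)" by (rule binary) (simp add: z_def)
    have min: "N z \<le> N z'" if "z' \<in> carrier_vec n" for z'
    proof (cases "\<forall>y<n. z' $ y \<in> {0, 1}")
      case True
      then have "N z' = F (S (\<lambda>y. z' $ y = 1))" by (intro binary') blast
      then show ?thesis using a by (simp add: Nz F_anti)
    next
      case False
      then show ?thesis using nonbinary(2)[of _ z' "S a"] ST[of a] by (auto simp: Nz)
    qed
    have "F (S a) \<le> R" using a0 a[of a0] unfolding FR by simp
    then have le: "N z powr (1 / p) \<le> R powr (1 / p)" using mono[of R z] R Nz by simp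
    have mem: "basis_mat p n G *\<^sub>v map_vec of_int z \<in> lattice_of (basis_mat p n G)"
      using z by (auto simp: lattice_of_def)
    have "is_arg_min (\<lambda>x. lp_norm p (x - target_vec p G)) (\<lambda>x. x \<in> lattice_of (basis_mat p n G))
        (basis_mat p n G *\<^sub>v map_vec of_int z)"
      unfolding is_arg_min_linorder using mem min mono[OF N_nonneg]
      by (auto simp: lattice_of_def norm z)
    then show "cvp_yes p inst" using le norm[OF z] rad by (auto simp: inst_def)
  qed
qed

section \<open>Polynomial time\<close>

text \<open>Lets time bounds be proved polynomial by introduction rules, without computing the
  polynomial.\<close>

definition polyfun :: "(nat \<Rightarrow> nat) \<Rightarrow> bool" where
  "polyfun f \<longleftrightarrow> (\<exists>q. \<forall>x. f x = poly q x)"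

lemma polyfun_const: "polyfun (\<lambda>_. c)"
  unfolding polyfun_def by (rule exI[of _ "[:c:]"]) simp

lemma polyfun_id: "polyfun (\<lambda>x. x)"
  unfolding polyfun_def by (rule exI[of _ "[:0, 1:]"]) simp

lemma polyfun_poly: "polyfun (poly q)"
  unfolding polyfun_def by blast

lemma polyfun_add: "polyfun f \<Longrightarrow> polyfun g \<Longrightarrow> polyfun (\<lambda>x. f x + g x)"
  unfolding polyfun_def by (metis poly_add)

lemma polyfun_mult: "polyfun f \<Longrightarrow> polyfun g \<Longrightarrow> polyfun (\<lambda>x. f x * g x)"
  unfolding polyfun_def by (metis poly_mult)

lemmas polyfun_intros = polyfun_const polyfun_id polyfun_poly polyfun_add polyfun_mult

lemma poly_nat_mono: "x \<le> y \<Longrightarrow> poly q x \<le> poly q y" for q :: "nat poly"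
  by (induction q) (auto intro: add_mono mult_mono)

text \<open>A common bound \<open>D\<close> for all size parameters makes the time a function of one
  argument; \<open>k\<close> is fixed.\<close>

lemma post_time_mono:
  assumes "m \<le> D" "d \<le> D" "l \<le> D" "n \<le> D"
  shows "post_time m d l k n \<le> post_time D D D k D"
  unfolding post_time_def clauses_time_def clause_time_def finish_time_def emit_time_def coef_time_def
  using assms by (intro add_mono mult_mono order_refl) auto

lemma polyfun_post_time: "polyfun f \<Longrightarrow> polyfun (\<lambda>x. post_time (f x) (f x) (f x) k (f x))"
  unfolding post_time_def clauses_time_def clause_time_def finish_time_def emit_time_def coef_time_def
  by (intro polyfun_intros)

section \<open>Sizes and shapes of the encodings\<close>

lemma vsize_enc_list_member: "a \<in> set xs \<Longrightarrow> vsize (f a) \<le> vsize (enc_list f xs)"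
  by (induction xs) auto

lemma length_bits_le: "length (bits w) \<le> vsize (enc_binary w)"
  by (simp add: enc_binary_def length_le_vsize)

lemma enc_wsat_conv:
  "enc_wsat I = VPair (enc_unary (nvars I)) (VPair (enc_list enc_clause (wclauses I)) (enc_binary (threshold I)))"
proof -
  have 1: "(\<lambda>(s, x). VPair (enc_bool s) (enc_unary x)) = enc_lit" by auto
  have 2: "(\<lambda>(C, w). VPair (enc_list enc_lit C) (enc_binary w)) = enc_clause" by auto
  show ?thesis unfolding enc_wsat_def 1 2 ..
qed

lemma enc_mat_basis_mat: "enc_mat (basis_mat p n G) = enc_list (enc_list VReal) (map (gadget_row p n) (rev G))"
proof -
  have len: "length (gadget_row p n g) = n" for g by (cases g) simp
  have "mat_to_list (basis_mat p n G) = map (gadget_row p n) (rev G)"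
    by (rule nth_equalityI)
      (auto intro!: nth_equalityI simp: mat_to_list_def basis_mat_def mat_of_rows_list_def len)
  then show ?thesis by (simp add: enc_mat_def)
qed

lemma enc_vec_target_vec: "enc_vec (target_vec p G) = enc_list VReal (map (gadget_target p) (rev G))"
  by (simp only: enc_vec_def target_vec_def list_vec)

section \<open>The reduction and its running time\<close>

definition reduction :: "(nat \<Rightarrow> real) \<Rightarrow> (nat \<Rightarrow> real mat) \<Rightarrow> (nat \<Rightarrow> real vec) \<Rightarrow> wsat \<Rightarrow> cvp" where
  "reduction p V t I = (let n = nvars I; \<tau> = power_sum (p n) (list_of_vec (t n));
       G = gadgets n \<tau> (mat_to_list (V n)) (list_of_vec (t n)) (wclauses I) (threshold I)
     in (basis_mat (p n) n G, target_vec (p n) G, radius (p n) n \<tau> (wclauses I) (threshold I)))"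

text \<open>Variable 50 is variable 0 of the shifted program: it passes \<open>n\<close> in and the
  parallelepiped out.\<close>

definition reduction_prog :: "real com \<Rightarrow> real com" where
  "reduction_prog c = (50 ::= Fst (Var 0) ;; shift 50 c ;; post_prog)"

lemma consts_reduction_prog: "consts_of (reduction_prog c) \<subseteq> consts_of c \<union> {0, 1}"
  by (auto simp: reduction_prog_def post_prog_def setup_prog_def clauses_prog_def finish_prog_def
      clause_prog_def emit_prog_def coef_prog_def read_binary_def read_unary_def For_def)

text \<open>In \<open>D\<close>, the part \<open>M * growth c\<close> bounds the height that
  \<open>c\<close> adds to its input, and the remaining \<open>M\<close> bounds the running time of
  \<open>c\<close> itself.\<close>

lemma reduction_prog_computes:
  fixes p :: "nat \<Rightarrow> real" and V :: "nat \<Rightarrow> real mat" and t :: "nat \<Rightarrow> real vec"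
  assumes I: "I \<in> weighted_max_ksat k" and k: "k \<ge> 2" and n: "n = nvars I"
    and iso: "isolating_parallelepiped (p n) k (V n) (t n)"
    and c: "computes_in c (enc_unary n) m (enc_parallelepiped (p n, V n, t n))" "m \<le> M"
    and D: "D = vsize (enc_wsat I) + M * (growth c + 1)"
  shows "\<exists>m' \<le> 1 + D + post_time D D D k D.
    computes_in (reduction_prog c) (enc_wsat I) m' (enc_cvp (reduction p V t I))"
proof -
  let ?s0 = "(\<lambda>_. VNil)(0 := enc_wsat I)"
  let ?u0 = "(\<lambda>_. VNil)(0 := enc_unary n)"
  let ?Cs = "wclauses I" and ?W = "threshold I" and ?tl = "list_of_vec (t n)"
  obtain u where u: "exec c ?u0 m u" "u 0 = enc_parallelepiped (p n, V n, t n)"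
    using c(1) unfolding computes_in_def by blast
  let ?s1 = "glue 50 ?s0 u"
  \<comment> \<open>From 50 on, nothing but the new input is set, so that part of the memory is an
    initial state of \<open>c\<close>.\<close>
  have "?s0(50 := enc_unary n) = glue 50 ?s0 ?u0"
    by (auto simp: glue_def)
  then have ex1: "exec (shift 50 c) (?s0(50 := enc_unary n)) m ?s1"
    using exec_shift[OF u(1), of 50 ?s0] by simp
  have size_n: "vsize (enc_unary n) \<le> vsize (enc_wsat I)" by (simp add: enc_wsat_conv n)
  have "n \<le> vsize (enc_unary n)"
    using length_le_vsize[of "[0..<n]" "\<lambda>_. VNil"] by (simp add: enc_unary_def)
  then have nD: "n \<le> D" using size_n by (simp add: D)
  have mD: "length ?Cs \<le> D"
    using length_le_vsize[of ?Cs enc_clause] by (simp add: enc_wsat_conv D)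
  have lD: "length (bits ?W) \<le> D"
    using length_bits_le[of ?W] by (simp add: enc_wsat_conv D)
  have lwD: "length (bits w) \<le> D" if "(C, w) \<in> set ?Cs" for C w
    using length_bits_le[of w] vsize_enc_list_member[OF that, of enc_clause] by (simp add: enc_wsat_conv D)
  \<comment> \<open>The entries of the target \<open>t n\<close> form a list inside the output of
    \<open>c\<close>, so the height of that output bounds their number.\<close>
  have "height (?u0 x) \<le> vsize (enc_unary n)" for x
    using height_le_vsize[of "enc_unary n"] by simp
  from height_exec[OF u(1) this order_refl, of 0]
  have "height (u 0) \<le> vsize (enc_unary n) + m * growth c" .
  moreover have "length ?tl \<le> height (u 0)"
    using length_le_height[of ?tl VReal] by (simp add: u(2) enc_vec_def)
  moreover have "m * growth c \<le> M * (growth c + 1)" using c(2) by (intro mult_mono) auto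
  ultimately have dD: "length ?tl \<le> D" using size_n by (simp add: D)
  have dims: "dim_col (V n) = k" "dim_vec (t n) = dim_row (V n)"
    using iso by (auto simp: isolating_parallelepiped_def)
  have clauses: "length C = k" "\<And>s x. (s, x) \<in> set C \<Longrightarrow> x < n" if "(C, w) \<in> set ?Cs" for C w
    using I that by (auto simp: weighted_max_ksat_def n)
  have "run post_prog ?s1 (\<lambda>m s'. m \<le> post_time (length ?Cs) (length ?tl) D k n \<and>
      s' 0 = enc_cvp (reduction p V t I))"
    unfolding reduction_def Let_def n[symmetric] enc_cvp.simps enc_mat_basis_mat enc_vec_target_vec
  proof (rule run_post, goal_cases)
    case 1
    then show ?case by (simp add: glue_def enc_wsat_conv n)
  next
    case 2
    then show ?case by (simp add: glue_def u(2) enc_mat_def enc_vec_def)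
  next
    case (7)
    then show ?case using k by simp
  qed (use dims clauses lwD lD in \<open>auto simp: mat_to_list_def less_imp_le\<close>)
  then obtain m2 s2 where s2: "exec post_prog ?s1 m2 s2" "m2 \<le> post_time (length ?Cs) (length ?tl) D k n"
    "s2 0 = enc_cvp (reduction p V t I)"
    unfolding run_def by blast
  have "exec (50 ::= Fst (Var 0)) ?s0 1 (?s0(50 := enc_unary n))"
    using exec_Assign[of 50 "Fst (Var 0)" ?s0] by (simp add: enc_wsat_conv n)
  then have "exec (reduction_prog c) ?s0 (1 + (m + m2)) s2"
    unfolding reduction_prog_def using ex1 s2(1) by (intro exec_Seq)
  moreover have "post_time (length ?Cs) (length ?tl) D k n \<le> post_time D D D k D"
    by (intro post_time_mono mD dD nD order_refl)
  moreover have "m \<le> D" using c(2) by (simp add: D)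
  ultimately show ?thesis unfolding computes_in_def using s2
    by (intro exI[of _ "1 + (m + m2)"]) auto
qed

theorem theorem3p2:
  fixes p :: "nat \<Rightarrow> real" and k :: nat and K :: "real set"
  assumes "\<And>n. 1 \<le> p n"
    and "k \<ge> 2"
    and "computable_isolating_parallelepiped K p k"
  shows "reduces_to_cvp K p (weighted_max_ksat k) \<and> reduces_to_cvp K p (max_ksat k)"
proof -
  obtain V t where iso: "\<And>n. isolating_parallelepiped (p n) k (V n) (t n)"
    and "poly_time_computable K UNIV enc_unary enc_parallelepiped (\<lambda>n. (p n, V n, t n))"
    using assms(3) unfolding computable_isolating_parallelepiped_def by blast
  then obtain c q where c: "consts_of c \<subseteq> K \<union> {0, 1}"
    and q: "\<And>n. \<exists>m \<le> poly q (vsize (enc_unary n)). computes_in c (enc_unary n) m (enc_parallelepiped (p n, V n, t n))"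
    unfolding poly_time_computable_def by blast
  \<comment> \<open>Here \<open>x\<close> is the size of the formula, which also bounds the size of
    the unary \<open>n\<close> that is the input of \<open>c\<close>.\<close>
  let ?D = "\<lambda>x. x + poly q x * (growth c + 1)"
  have "polyfun (\<lambda>x. 1 + ?D x + post_time (?D x) (?D x) (?D x) k (?D x))"
    by (intro polyfun_intros polyfun_post_time)
  then obtain r where r: "\<And>x. 1 + ?D x + post_time (?D x) (?D x) (?D x) k (?D x) = poly r x"
    unfolding polyfun_def by blast
  have "\<exists>m \<le> poly r (vsize (enc_wsat I)). computes_in (reduction_prog c) (enc_wsat I) m (enc_cvp (reduction p V t I))"
    if I: "I \<in> weighted_max_ksat k" for I
  proof -
    obtain m where m: "m \<le> poly q (vsize (enc_unary (nvars I)))"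
      "computes_in c (enc_unary (nvars I)) m (enc_parallelepiped (p (nvars I), V (nvars I), t (nvars I)))"
      using q by blast
    have "poly q (vsize (enc_unary (nvars I))) \<le> poly q (vsize (enc_wsat I))"
      by (intro poly_nat_mono) (simp add: enc_wsat_conv)
    with m(1) have "m \<le> poly q (vsize (enc_wsat I))" by simp
    from reduction_prog_computes[where p = p and V = V and t = t, OF I assms(2) refl iso m(2) this refl]
    show ?thesis unfolding r .
  qed
  moreover have "consts_of (reduction_prog c) \<subseteq> K \<union> {0, 1}"
    using consts_reduction_prog[of c] c by blast
  ultimately have time: "poly_time_computable K (weighted_max_ksat k) enc_wsat enc_cvp (reduction p V t)"
    unfolding poly_time_computable_def by blast
  have correct: "cvp_instance (nvars I) (reduction p V t I) \<and>
      (max_sat_yes I \<longleftrightarrow> cvp_yes (p (nvars I)) (reduction p V t I))"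
    if I: "I \<in> weighted_max_ksat k" for I
  proof -
    note rc = reduction_correct[where n = "nvars I" and Cs = "wclauses I" and W = "threshold I", OF iso assms(1)]
    have "length C = k" if "(C, w) \<in> set (wclauses I)" for C w
      using I that by (auto simp: weighted_max_ksat_def)
    moreover have "x < nvars I" if "(C, w) \<in> set (wclauses I)" "(s, x) \<in> set C" for C w s x
      using I that by (auto simp: weighted_max_ksat_def)
    ultimately show ?thesis
      unfolding reduction_def Let_def max_sat_yes_def satisfied_weight_def by (intro conjI rc sym[OF rc(2)]) auto
  qed
  \<comment> \<open>Unweighted instances are encoded in the same way, so the same program serves
    them.\<close>
  have sub: "max_ksat k \<subseteq> weighted_max_ksat k" by (auto simp: max_ksat_def)
  then have "poly_time_computable K (max_ksat k) enc_wsat enc_cvp (reduction p V t)"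
    using time unfolding poly_time_computable_def by blast
  with time correct sub show ?thesis unfolding reduces_to_cvp_def by blast
qed

end
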